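(* Let $n,m\ge 0$ be integers and $0<a<1$. Let $\beta_k^{(n,m)}(a)$, $n\wedge m\le k\le n+m$, be the coefficients in the polynomial identity $$q_n(au)\,q_m((1-a)u)=\sum_{k=n\wedge m}^{n+m}\beta_k^{(n,m)}(a)\,q_k(u).$$ Then $\beta_k^{(n,m)}(a)\ge 0$, $\sum_{k=n\wedge m}^{n+m}\beta_k^{(n,m)}(a)=1$, and for all $x\in\mathbb R$ $$\left(\frac1a f_{n+\frac12}\!\left(\frac{\cdot}{a}\right)*\frac1{1-a}f_{m+\frac12}\!\left(\frac{\cdot}{1-a}\right)\right)(x)=\sum_{k=n\wedge m}^{n+m}\beta_k^{(n,m)}(a)\,f_{k+\frac12}(x).$$ That is, if $X,Y$ are independent random variables with densities $f_{n+\frac12}$ and $f_{m+\frac12}$, then $aX+(1-a)Y$ has a density which is a convex combination of the densities $f_{k+\frac12}$, $n\wedge m\le k\le n+m$.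
   Context: For integers $n\ge0$, the (normalized) Bessel polynomial $q_n$ of degree $n$ is $$q_n(u)=\sum_{k=0}^{n}\alpha_k^{(n)}u^k,\qquad \alpha_k^{(n)}=\frac{n!\,(2n-k)!\,2^k}{(2n)!\,(n-k)!\,k!}.$$ Since $q_k$ has degree exactly $k$, expansions in the $q_k$ are unique. For $\nu>0$, $f_\nu$ is the probability density on $\mathbb R$ (Student-t density with $2\nu$ degrees of freedom, without the usual scaling) $$f_\nu(x)=\frac{A_\nu}{(1+x^2)^{\nu+\frac12}},\qquad A_\nu=\frac{\Gamma(\nu+\frac12)}{\Gamma(\frac12)\Gamma(\nu)}.$$ $*$ is ordinary convolution of densities on $\mathbb R$, and $x\wedge y=\min(x,y)$. *)

theory Defs
  imports "HOL-Probability.Probability" "HOL-Computational_Algebra.Polynomial"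
begin

definition bessel_coeff :: "nat \<Rightarrow> nat \<Rightarrow> real" where
  "bessel_coeff n k =
     (fact n * fact (2 * n - k) * 2 ^ k) / (fact (2 * n) * fact (n - k) * fact k)"

definition bessel_poly :: "nat \<Rightarrow> real poly" where
  "bessel_poly n = (\<Sum>k=0..n. monom (bessel_coeff n k) k)"

text \<open>\<open>\<beta> k\<close> is constrained only for \<open>min n m \<le> k \<le> n + m\<close>. The left-hand side is
  the product of \<open>bessel_poly n\<close> at \<open>a u\<close> and \<open>bessel_poly m\<close> at \<open>(1 - a) u\<close>, as a polynomial
  in \<open>u\<close>.\<close>

definition bessel_product_expansion :: "nat \<Rightarrow> nat \<Rightarrow> real \<Rightarrow> (nat \<Rightarrow> real) \<Rightarrow> bool" where
  "bessel_product_expansion n m a \<beta> \<longleftrightarrow>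
     pcompose (bessel_poly n) [:0, a:] * pcompose (bessel_poly m) [:0, 1 - a:]
       = (\<Sum>k=min n m..n + m. smult (\<beta> k) (bessel_poly k))"

definition student_const :: "real \<Rightarrow> real" where
  "student_const \<nu> = Gamma (\<nu> + 1/2) / (Gamma (1/2) * Gamma \<nu>)"

definition student_density :: "real \<Rightarrow> real \<Rightarrow> real" where
  "student_density \<nu> x = student_const \<nu> / (1 + x\<^sup>2) powr (\<nu> + 1/2)"

definition scaled_density :: "real \<Rightarrow> (real \<Rightarrow> real) \<Rightarrow> real \<Rightarrow> real" where
  "scaled_density a f x = 1 / a * f (x / a)"

text \<open>The library's \<open>convolution\<close> acts on measures; this is the pointwise convolution of
  functions. The integral is \<open>0\<close> by convention where the integrand is not integrable.\<close>

definition fun_convolution :: "(real \<Rightarrow> real) \<Rightarrow> (real \<Rightarrow> real) \<Rightarrow> real \<Rightarrow> real" where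
  "fun_convolution f g x = (LINT y|lborel. f (x - y) * g y)"

end

theory Submission
  imports Defs "HOL-Computational_Algebra.Formal_Power_Series"
begin

text \<open>The function \<open>k\<^sub>n(u) = exp (-u) q\<^sub>n(u)\<close> satisfies \<open>k\<^sub>n' = - u k\<^sub>n\<^sub>-\<^sub>1 / (2n - 1)\<close>. Differentiating
  \<open>k\<^sub>n(au) k\<^sub>m((1 - a)u) = \<Sum> \<beta>\<^sub>k k\<^sub>k(u)\<close> therefore expresses the coefficients for \<open>(n, m)\<close> as positive
  combinations of those for \<open>(n - 1, m)\<close> and \<open>(n, m - 1)\<close>, which reduces nonnegativity and the vanishing
  of the low coefficients to \<open>min n m = 0\<close>. There the inversion formula for \<open>u\<^sup>k\<close> in the basis \<open>q\<^sub>i\<close>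
  shows that \<open>\<beta>\<^sub>i\<close> is a positive multiple of the coefficient of \<open>z\<^sup>n\<^sup>-\<^sup>i\<close> in
  \<open>(1 - z)\<^bsup>-(n+1)\<^esup> (1 - az)\<^sup>i (1 - 2az)\<close>, and writing \<open>1 - az = (1 - z) + (1 - a)z\<close> exhibits it as
  nonnegative.

  On the analytic side \<open>k\<^sub>n(\<bar>t\<bar>)\<close> is the characteristic function of \<open>f\<^sub>n\<^sub>+\<^sub>1\<^sub>/\<^sub>2\<close>: the characteristic functions
  obey the same first-order recursion, and the Cauchy case \<open>n = 0\<close> follows from a second-order linear
  differential equation that becomes available by also considering \<open>n = 1\<close>. The polynomial identity is
  then an identity of characteristic functions, so Levy's uniqueness theorem identifies the two laws;
  their densities agree almost everywhere, and everywhere by continuity.\<close>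

subsection \<open>Recurrences for Bessel polynomials\<close>

lemma coeff_bessel_poly: "coeff (bessel_poly n) k = (if k \<le> n then bessel_coeff n k else 0)"
  by (auto simp: bessel_poly_def coeff_sum)

text \<open>Writing \<open>n = k + d\<close> turns the truncated differences into sums, so that the
  coefficient identities below become identities between fractions.\<close>

lemma bessel_coeff_add:
  "bessel_coeff (k + d) k = fact (k + d) * fact (k + 2 * d) * 2 ^ k / (fact (2 * k + 2 * d) * fact d * fact k)"
  by (simp add: bessel_coeff_def algebra_simps)

lemma bessel_coeff_0 [simp]: "bessel_coeff n 0 = 1"
  by (simp add: bessel_coeff_def)

lemma bessel_coeff_pos: "0 < bessel_coeff n k"
  by (simp add: bessel_coeff_def)

lemma bessel_poly_0: "bessel_poly 0 = 1"
  by (simp add: bessel_poly_def)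

lemma bessel_poly_1: "bessel_poly 1 = [:1, 1:]"
  by (rule poly_eqI) (auto simp: coeff_bessel_poly coeff_pCons bessel_coeff_def split: nat.split)

text \<open>This is the coefficient of \<open>u^(j+1)\<close> in
  \<open>q_(n+1)' - q_(n+1) = - u q_n / (2n + 1)\<close>. The guard stands for the degree bound,
  because \<open>bessel_coeff\<close> itself stays positive beyond the degree.\<close>

lemma bessel_coeff_deriv_diff:
  assumes "j \<le> n"
  shows "bessel_coeff (Suc n) (Suc j)
    = real (Suc (Suc j)) * (if Suc j \<le> n then bessel_coeff (Suc n) (Suc (Suc j)) else 0)
      + bessel_coeff n j / (2 * real n + 1)"
proof -
  obtain d where n: "n = j + d" using assms le_Suc_ex by blast
  define A B C D :: real where "A = fact (j + d)" and "B = fact (j + 2 * d)"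
    and "C = fact (2 * j + 2 * d)" and "D = fact d"
  have nz: "A \<noteq> 0" "B \<noteq> 0" "C \<noteq> 0" "D \<noteq> 0"
    by (auto simp: A_def B_def C_def D_def)
  have 1: "bessel_coeff (Suc n) (Suc j) = (real j + real d + 1) * A * ((real j + 2 * real d + 1) * B)
      * (2 * 2 ^ j) / ((2 * real j + 2 * real d + 2) * (2 * real j + 2 * real d + 1) * C * D * ((real j + 1) * fact j))"
    using bessel_coeff_add[of "Suc j" d] by (simp add: n A_def B_def C_def D_def algebra_simps)
  have 2: "bessel_coeff n j = A * B * 2 ^ j / (C * D * fact j)"
    using bessel_coeff_add[of j d] by (simp add: n A_def B_def C_def D_def algebra_simps)
  \<comment> \<open>The trailing factor \<open>real d\<close> merges both cases: it vanishes
    together with the left side at \<open>d = 0\<close>, and otherwise it cancels the leading factor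
    of \<open>D = d!\<close>.\<close>
  have 3: "(if Suc j \<le> n then bessel_coeff (Suc n) (Suc (Suc j)) else 0)
    = (real j + real d + 1) * A * B * (4 * 2 ^ j)
      / ((2 * real j + 2 * real d + 2) * (2 * real j + 2 * real d + 1) * C * D
          * ((real j + 2) * (real j + 1) * fact j)) * real d"
  proof (cases d)
    case 0
    then show ?thesis by (simp add: n)
  next
    case (Suc d')
    have D: "D = real d * fact d'" by (simp add: D_def Suc)
    show ?thesis
      using bessel_coeff_add[of "Suc (Suc j)" d'] unfolding D
      by (simp add: n A_def B_def C_def Suc) (simp add: divide_simps, simp add: algebra_simps)
  qed
  have j: "real j + 1 > 0" "real j + 2 > 0" "2 * real j + 2 * real d + 1 > 0" "2 * real j + 2 * real d + 2 > 0"
    by simp_all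
  show ?thesis
    unfolding 1 2 3 using nz j
    by (simp add: n, simp add: divide_simps, simp add: algebra_simps)
qed

text \<open>This is the coefficient of \<open>u^(j+2)\<close> in
  \<open>q_(n+2) = q_(n+1) + u^2 q_n / ((2n+1)(2n+3))\<close>, with the guard again encoding the
  degree bound.\<close>

lemma bessel_coeff_three_term:
  assumes "j \<le> n"
  shows "bessel_coeff (Suc (Suc n)) (Suc (Suc j))
    = (if Suc j \<le> n then bessel_coeff (Suc n) (Suc (Suc j)) else 0)
      + bessel_coeff n j / ((2 * real n + 1) * (2 * real n + 3))"
proof -
  obtain d where n: "n = j + d" using assms le_Suc_ex by blast
  define A B C D :: real where "A = fact (j + d)" and "B = fact (j + 2 * d)"
    and "C = fact (2 * j + 2 * d)" and "D = fact d"
  have nz: "A \<noteq> 0" "B \<noteq> 0" "C \<noteq> 0" "D \<noteq> 0"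
    by (auto simp: A_def B_def C_def D_def)
  have 1: "bessel_coeff (Suc (Suc n)) (Suc (Suc j))
    = (real j + real d + 2) * (real j + real d + 1) * A
      * ((real j + 2 * real d + 2) * (real j + 2 * real d + 1) * B) * (4 * 2 ^ j)
      / ((2 * real j + 2 * real d + 4) * (2 * real j + 2 * real d + 3) * (2 * real j + 2 * real d + 2)
         * (2 * real j + 2 * real d + 1) * C * D * ((real j + 2) * (real j + 1) * fact j))"
    using bessel_coeff_add[of "Suc (Suc j)" d] by (simp add: n A_def B_def C_def D_def algebra_simps)
  have 2: "bessel_coeff n j = A * B * 2 ^ j / (C * D * fact j)"
    using bessel_coeff_add[of j d] by (simp add: n A_def B_def C_def D_def algebra_simps)
  have 3: "(if Suc j \<le> n then bessel_coeff (Suc n) (Suc (Suc j)) else 0)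
    = (real j + real d + 1) * A * B * (4 * 2 ^ j)
      / ((2 * real j + 2 * real d + 2) * (2 * real j + 2 * real d + 1) * C * D
          * ((real j + 2) * (real j + 1) * fact j)) * real d"
  proof (cases d)
    case 0
    then show ?thesis by (simp add: n)
  next
    case (Suc d')
    have D: "D = real d * fact d'" by (simp add: D_def Suc)
    show ?thesis
      using bessel_coeff_add[of "Suc (Suc j)" d'] unfolding D
      by (simp add: n A_def B_def C_def Suc) (simp add: divide_simps, simp add: algebra_simps)
  qed
  have j: "real j + 1 > 0" "real j + 2 > 0" "2 * real j + 2 * real d + 1 > 0" "2 * real j + 2 * real d + 2 > 0"
     "2 * real j + 2 * real d + 3 > 0" "2 * real j + 2 * real d + 4 > 0"
    by simp_all
  show ?thesis
    unfolding 1 2 3 using nz j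
    by (simp add: n, simp add: divide_simps, simp add: algebra_simps)
qed

lemma bessel_coeff_1: "bessel_coeff (Suc n) (Suc 0) = 1"
  by (simp add: bessel_coeff_def)

text \<open>Since \<open>p' - p = exp(u) (exp(-u) p)'\<close>, this is the derivative rule for
  \<open>exp(-u) q_(n+1)(u)\<close> in purely polynomial form.\<close>

lemma bessel_poly_deriv:
  "pderiv (bessel_poly (Suc n)) - bessel_poly (Suc n)
    = smult (- 1 / (2 * real n + 1)) (pCons 0 (bessel_poly n))"
proof (rule poly_eqI)
  fix j
  show "coeff (pderiv (bessel_poly (Suc n)) - bessel_poly (Suc n)) j
    = coeff (smult (- 1 / (2 * real n + 1)) (pCons 0 (bessel_poly n))) j"
  proof (cases j)
    case 0
    then show ?thesis by (simp add: coeff_pderiv coeff_bessel_poly bessel_coeff_1)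
  next
    case (Suc i)
    then show ?thesis
      using bessel_coeff_deriv_diff[of i n]
      by (auto simp: coeff_pderiv coeff_bessel_poly)
  qed
qed

lemma bessel_poly_three_term:
  "bessel_poly (Suc (Suc n)) = bessel_poly (Suc n)
    + smult (1 / ((2 * real n + 1) * (2 * real n + 3))) (pCons 0 (pCons 0 (bessel_poly n)))"
proof (rule poly_eqI)
  fix j
  show "coeff (bessel_poly (Suc (Suc n))) j = coeff (bessel_poly (Suc n)
    + smult (1 / ((2 * real n + 1) * (2 * real n + 3))) (pCons 0 (pCons 0 (bessel_poly n)))) j"
  proof (cases j)
    case 0
    then show ?thesis by (simp add: coeff_bessel_poly)
  next
    case (Suc i)
    show ?thesis
    proof (cases i)
      case 0
      with Suc show ?thesis by (simp add: coeff_bessel_poly bessel_coeff_1)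
    next
      case (Suc i')
      with \<open>j = Suc i\<close> show ?thesis
        using bessel_coeff_three_term[of i' n] by (auto simp: coeff_bessel_poly)
    qed
  qed
qed

text \<open>Differentiation lowers the degree of a nonconstant polynomial. Consequently
  \<open>pderiv p - p\<close> determines \<open>p\<close>, and no constant of integration has to be
  fixed later.\<close>

lemma pderiv_eq_self_imp_0:
  assumes "pderiv p = (p :: real poly)"
  shows "p = 0"
proof (rule ccontr)
  assume "p \<noteq> 0"
  have "degree p = 0"
    using degree_pderiv[of p] assms by simp
  then have "pderiv p = 0" by (simp add: pderiv_eq_0_iff)
  with assms \<open>p \<noteq> 0\<close> show False by simp
qed

subsection \<open>Expansion of monomials and of rescaled Bessel polynomials\<close>

text \<open>Carlitz's inversion formula: \<open>carlitz_coeff k i\<close> is the coefficient of \<open>q\<^sub>i\<close> in \<open>u\<^sup>k\<close>. The guard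
  is needed because truncated subtraction would give \<open>Suc i choose 0\<close> for \<open>i > k\<close>.\<close>

definition carlitz_coeff :: "nat \<Rightarrow> nat \<Rightarrow> real" where
  "carlitz_coeff k i = (if i \<le> k then (- 1) ^ (k - i) * real (Suc i choose (k - i)) * fact (Suc k) / 2 ^ k
     * fact (2 * i) / (fact i * fact (Suc i)) else 0)"

lemma carlitz_coeff_add:
  "carlitz_coeff (i + s) i = (- 1) ^ s * real (Suc i choose s) * fact (Suc (i + s)) / 2 ^ (i + s)
     * fact (2 * i) / (fact i * fact (Suc i))"
  by (simp add: carlitz_coeff_def)

lemma carlitz_coeff_eq_0: "k < i \<Longrightarrow> carlitz_coeff k i = 0"
  by (simp add: carlitz_coeff_def)

lemma carlitz_coeff_rec_0: "carlitz_coeff (Suc (Suc k)) 0 = 0"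
  by (simp add: carlitz_coeff_def)

lemma carlitz_coeff_rec_1: "carlitz_coeff (Suc (Suc k)) 1 = - 3 * carlitz_coeff k 0"
proof -
  \<comment> \<open>From \<open>k = 2\<close> on both sides vanish, since the binomials
    \<open>2 choose (k + 1)\<close> and \<open>1 choose k\<close> do.\<close>
  consider "k = 0" | "k = 1" | j where "k = Suc (Suc j)"
    by (metis One_nat_def nat.exhaust)
  then show ?thesis
    by cases (auto simp: carlitz_coeff_def numeral_2_eq_2 field_simps)
qed

lemma binomial_absorb_comp_real:
  "(real m + 1 - real s) * real (Suc m choose s) = (real m + 1) * real (m choose s)"
proof (cases "s \<le> Suc m")
  case True
  then show ?thesis
    using arg_cong[OF binomial_absorb_comp[of "Suc m" s], of real]
    by (simp only: of_nat_mult of_nat_diff of_nat_Suc diff_Suc_1 add.commute)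
qed (simp add: binomial_eq_0)

text \<open>This is what remains of the recurrence for \<open>carlitz_coeff\<close> at
  \<open>k = i + s\<close> once the factorials cancel. By absorption all three binomials are
  expressed through \<open>N\<close>, leaving
  \<open>(s+i+3)(s+i+2) = (i+2-s)(i+3-s) + 2(2i+5)s\<close>.\<close>

lemma binomial_carlitz_step:
  "real (Suc (Suc (Suc i)) choose s) * (real s + real i + 3) * (real s + real i + 2)
    = (real i + 2) * (real i + 3) * real (Suc i choose s)
      + 2 * (real i + 3) * (2 * real i + 5) * (if s = 0 then 0 else real (Suc (Suc i) choose (s - 1)))"
proof -
  define N where "N = real (Suc (Suc (Suc i)) choose s)"
  define B where "B = (if s = 0 then 0 else real (Suc (Suc i) choose (s - 1)))"
  have a: "(real i + 3) * B = real s * N"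
  proof (cases s)
    case (Suc r)
    then show ?thesis
      using Suc_times_binomial_eq[of "Suc (Suc i)" r] unfolding N_def B_def
      by (simp flip: of_nat_mult add: algebra_simps)
  qed (simp add: B_def)
  have "(real i + 2) * (real i + 3) * real (Suc i choose s)
    = (real i + 3) * ((real i + 2 - real s) * real (Suc (Suc i) choose s))"
    using binomial_absorb_comp_real[of "Suc i" s] by (simp add: algebra_simps)
  also have "\<dots> = (real i + 2 - real s) * ((real i + 3) * real (Suc (Suc i) choose s))"
    by (simp only: mult_ac)
  also have "(real i + 3) * real (Suc (Suc i) choose s) = (real i + 3 - real s) * N"
    using binomial_absorb_comp_real[of "Suc (Suc i)" s] unfolding N_def by (simp add: algebra_simps)
  finally have b: "(real i + 2) * (real i + 3) * real (Suc i choose s) = (real i + 2 - real s) * ((real i + 3 - real s) * N)" .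
  have c: "2 * (real i + 3) * (2 * real i + 5) * B = 2 * (2 * real i + 5) * (real s * N)"
    unfolding a[symmetric] by (simp only: mult_ac)
  show ?thesis
    unfolding N_def[symmetric] B_def[symmetric] b c by (simp add: algebra_simps)
qed

text \<open>The three-term recurrence gives
  \<open>u^2 q_i = (2i+1)(2i+3) (q_(i+2) - q_(i+1))\<close>; the claim is the resulting coefficient
  of \<open>q_(i+2)\<close> when the expansion of \<open>u^k\<close> is multiplied by
  \<open>u^2\<close>.\<close>

lemma carlitz_coeff_rec:
  "carlitz_coeff (Suc (Suc k)) (Suc (Suc i))
    = (2 * real i + 1) * (2 * real i + 3) * carlitz_coeff k i
      - (2 * real i + 3) * (2 * real i + 5) * carlitz_coeff k (Suc i)"
proof (cases "i \<le> k")
  case False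
  then show ?thesis by (simp add: carlitz_coeff_def)
next
  case True
  then obtain s where k: "k = i + s" using le_Suc_ex by blast
  define E F G H P :: real where "E = (-1) ^ s" and "F = fact (Suc k)" and "G = fact (2 * i)"
    and "H = fact i" and "P = 2 ^ k"
  define Ca Cb Cc where "Ca = real (Suc i choose s)" and "Cb = real (Suc (Suc (Suc i)) choose s)"
    and "Cc = (if s = 0 then 0 else real (Suc (Suc i) choose (s - 1)))"
  have nz: "H \<noteq> 0" "P \<noteq> 0" by (auto simp: H_def P_def)
  \<comment> \<open>\<open>R\<close> is the common factor of the three coefficients; without it the
    recurrence reduces to \<open>step\<close>.\<close>
  define R where "R = E * F * G / (P * H * H)"
  have step: "Cb * (real s + real i + 3) * (real s + real i + 2)
    = (real i + 2) * (real i + 3) * Ca + 2 * (real i + 3) * (2 * real i + 5) * Cc"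
    unfolding Ca_def Cb_def Cc_def by (rule binomial_carlitz_step)
  have 1: "carlitz_coeff (Suc (Suc k)) (Suc (Suc i))
    = R * (Cb * (real s + real i + 3) * (real s + real i + 2)) / 4
       * ((2 * real i + 4) * (2 * real i + 3) * (2 * real i + 2) * (2 * real i + 1))
         / ((real i + 2) * (real i + 1) * (real i + 3) * (real i + 2) * (real i + 1))"
  proof -
    have "fact (2 * Suc (Suc i)) = (2 * real i + 4) * (2 * real i + 3) * (2 * real i + 2) * (2 * real i + 1) * G"
      by (simp add: G_def algebra_simps)
    moreover have "fact (Suc (Suc i)) = (real i + 2) * (real i + 1) * H" by (simp add: H_def algebra_simps)
    moreover have "fact (Suc (Suc (Suc i))) = (real i + 3) * (real i + 2) * (real i + 1) * H" by (simp add: H_def algebra_simps)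
    moreover have "fact (Suc (Suc (Suc k))) = (real s + real i + 3) * (real s + real i + 2) * F"
      by (simp add: F_def k algebra_simps)
    moreover have "2 ^ Suc (Suc k) = 4 * P" by (simp add: P_def)
    moreover have "carlitz_coeff (Suc (Suc k)) (Suc (Suc i)) = E * Cb * fact (Suc (Suc (Suc k))) / 2 ^ Suc (Suc k)
        * fact (2 * Suc (Suc i)) / (fact (Suc (Suc i)) * fact (Suc (Suc (Suc i))))"
      using carlitz_coeff_add[of "Suc (Suc i)" s] unfolding E_def Cb_def k add_Suc .
    ultimately show ?thesis
      unfolding R_def by (simp only: times_divide_eq_left times_divide_eq_right divide_divide_eq_left mult_ac)
  qed
  have 2: "carlitz_coeff k i = R * Ca / (real i + 1)"
    unfolding R_def E_def F_def G_def P_def Ca_def k H_def carlitz_coeff_add by (simp add: divide_simps algebra_simps)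
  have 3: "carlitz_coeff k (Suc i) = - (R * Cc * ((2 * real i + 2) * (2 * real i + 1)) / ((real i + 1) * (real i + 2) * (real i + 1)))"
  proof (cases s)
    case 0
    then show ?thesis by (simp add: Cc_def carlitz_coeff_eq_0 k)
  next
    case (Suc r)
    have "fact (2 * Suc i) = (2 * real i + 2) * (2 * real i + 1) * G"
      by (simp add: G_def algebra_simps)
    moreover have "fact (Suc (Suc i)) = (real i + 2) * (real i + 1) * H" by (simp add: H_def algebra_simps)
    moreover have "fact (Suc i) = (real i + 1) * H" by (simp add: H_def algebra_simps)
    moreover have "carlitz_coeff k (Suc i) = - (E * Cc * F / P
        * fact (2 * Suc i) / (fact (Suc i) * fact (Suc (Suc i))))"
      using carlitz_coeff_add[of "Suc i" r] unfolding E_def Cc_def k Suc P_def F_def by simp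
    ultimately show ?thesis
      unfolding R_def by (simp only: times_divide_eq_left times_divide_eq_right divide_divide_eq_left mult_ac)
  qed
  have "real i + 1 > 0" "real i + 2 > 0" "real i + 3 > 0" by simp_all
  then show ?thesis
    unfolding 1 2 3 step
    by (simp add: divide_simps, simp add: algebra_simps)
qed

lemma pCons_0_sum: "pCons 0 (\<Sum>i\<in>A. f i) = (\<Sum>i\<in>A. pCons 0 (f i))"
  by (rule sum_comp_morphism[symmetric, unfolded o_def]) auto

text \<open>The induction advances by two, because the three-term recurrence describes
  multiplication of the basis by \<open>u^2\<close>, not by \<open>u\<close>.\<close>

lemma monom_eq_sum_bessel_poly:
  "monom 1 k = (\<Sum>i\<le>k. smult (carlitz_coeff k i) (bessel_poly i))"
proof (induction k rule: induct_nat_012)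
  case 0
  show ?case by (simp add: carlitz_coeff_def bessel_poly_0)
next
  case 1
  show ?case
    using bessel_poly_1 by (simp add: carlitz_coeff_def bessel_poly_0 monom_Suc one_pCons)
next
  case (ge2 k)
  let ?c = carlitz_coeff and ?q = bessel_poly
  have step: "pCons 0 (pCons 0 (?q i)) = smult ((2 * real i + 1) * (2 * real i + 3)) (?q (Suc (Suc i)) - ?q (Suc i))" for i
    by (subst bessel_poly_three_term) (simp add: add_pos_pos)
  have "monom 1 (Suc (Suc k)) = pCons 0 (pCons 0 (monom (1::real) k))"
    by (simp add: monom_Suc)
  also have "\<dots> = (\<Sum>i\<le>k. smult (?c k i) (pCons 0 (pCons 0 (?q i))))"
    by (subst ge2(1)) (simp add: pCons_0_sum)
  also have "\<dots> = (\<Sum>i\<le>k. smult ((2 * real i + 1) * (2 * real i + 3) * ?c k i) (?q (Suc (Suc i))))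
      - (\<Sum>i\<le>k. smult ((2 * real i + 1) * (2 * real i + 3) * ?c k i) (?q (Suc i)))"
    by (simp add: step smult_diff_right sum_subtractf algebra_simps)
  \<comment> \<open>Shifting the index aligns both sums on \<open>q_(i+2)\<close>. The added top
    term is zero since \<open>carlitz_coeff k (k+1) = 0\<close>, and the split-off bottom term is
    the contribution of \<open>q_1\<close>.\<close>
  also have "(\<Sum>i\<le>k. smult ((2 * real i + 1) * (2 * real i + 3) * ?c k i) (?q (Suc i)))
     = smult (3 * ?c k 0) (?q 1) + (\<Sum>i\<le>k. smult ((2 * real i + 3) * (2 * real i + 5) * ?c k (Suc i)) (?q (Suc (Suc i))))"
  proof -
    have "(\<Sum>i\<le>k. smult ((2 * real i + 1) * (2 * real i + 3) * ?c k i) (?q (Suc i)))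
      = (\<Sum>i\<le>Suc k. smult ((2 * real i + 1) * (2 * real i + 3) * ?c k i) (?q (Suc i)))"
      by (simp add: carlitz_coeff_eq_0)
    also have "\<dots> = smult (3 * ?c k 0) (?q 1) + (\<Sum>i\<le>k. smult ((2 * real i + 3) * (2 * real i + 5) * ?c k (Suc i)) (?q (Suc (Suc i))))"
      by (subst sum.atMost_Suc_shift) (simp add: algebra_simps)
    finally show ?thesis .
  qed
  also have "(\<Sum>i\<le>k. smult ((2 * real i + 1) * (2 * real i + 3) * ?c k i) (?q (Suc (Suc i)))) -
     (smult (3 * ?c k 0) (?q 1) + (\<Sum>i\<le>k. smult ((2 * real i + 3) * (2 * real i + 5) * ?c k (Suc i)) (?q (Suc (Suc i)))))
     = smult (- 3 * ?c k 0) (?q 1) + (\<Sum>i\<le>k. smult (?c (Suc (Suc k)) (Suc (Suc i))) (?q (Suc (Suc i))))"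
    by (simp add: carlitz_coeff_rec smult_diff_left sum_subtractf)
  also have "\<dots> = (\<Sum>i\<le>Suc (Suc k). smult (?c (Suc (Suc k)) i) (?q i))"
    by (simp only: sum.atMost_Suc_shift[of _ "Suc k"] sum.atMost_Suc_shift[of _ k])
       (simp add: carlitz_coeff_rec_0 carlitz_coeff_rec_1[simplified])
  finally show ?case .
qed

section \<open>Power series behind the rescaling coefficients\<close>

unbundle fps_syntax

definition geometric_fps :: "real fps" where "geometric_fps = Abs_fps (\<lambda>_. 1)"

lemma one_minus_X_mult_geometric_fps: "(1 - fps_X) * geometric_fps = 1"
  by (rule fps_ext) (auto simp: geometric_fps_def left_diff_distrib fps_X_mult_nth)

text \<open>Multiplication by the geometric series takes partial sums, which the hockey-stick
  identity evaluates.\<close>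

lemma geometric_fps_power_nth: "(geometric_fps ^ Suc p) $ n = real (p + n choose n)"
proof (induction p arbitrary: n)
  case 0
  then show ?case by (simp add: geometric_fps_def)
next
  case (Suc p)
  have "(geometric_fps ^ Suc (Suc p)) $ n = (\<Sum>i=0..n. (geometric_fps ^ Suc p) $ i)"
    unfolding power_Suc2[of geometric_fps "Suc p"] fps_mult_nth by (simp add: geometric_fps_def)
  also have "\<dots> = real (\<Sum>i\<le>n. (p + i choose i))"
    by (simp only: Suc of_nat_sum atLeast0AtMost)
  also have "\<dots> = real (Suc p + n choose n)"
    by (simp only: sum_choose_lower add_Suc)
  finally show ?case .
qed

lemma fps_mult_one_minus_const_X_nth:
  "(F * (1 - fps_const c * fps_X)) $ n = F $ n - c * (if n = 0 then 0 else (F :: real fps) $ (n - 1))"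
proof -
  have "F * (1 - fps_const c * fps_X) = F - fps_const c * (F * fps_X)"
    by (simp add: algebra_simps)
  then show ?thesis by (auto simp: fps_X_mult_right_nth)
qed

lemma one_minus_const_X_power_nth:
  "((1 - fps_const c * fps_X) ^ i) $ j = real (i choose j) * (- c :: real) ^ j"
proof (induction i arbitrary: j)
  case 0
  then show ?case by (cases j) auto
next
  case (Suc i)
  then show ?case
    unfolding power_Suc2 fps_mult_one_minus_const_X_nth by (cases j) (auto simp: algebra_simps)
qed

text \<open>The exponent \<open>p\<close> is independent of \<open>i\<close> because the induction
  for nonnegativity lowers it; the coefficients of \<open>q_n(au)\<close> use
  \<open>p = n + 1\<close>.\<close>

definition rescaling_fps :: "real \<Rightarrow> nat \<Rightarrow> nat \<Rightarrow> real fps" where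
  "rescaling_fps a p i = geometric_fps ^ p * ((1 - fps_const a * fps_X) ^ i * (1 - fps_const (2 * a) * fps_X))"

text \<open>Induction on \<open>i\<close> using \<open>1 - az = (1 - z) + (1 - a)z\<close>: both resulting terms preserve the condition
  \<open>N + i + 1 \<le> p\<close>, and for \<open>i = 0\<close> it makes consecutive coefficients of \<open>(1 - z)\<^bsup>-p\<^esup>\<close> grow at least
  by a factor of two.\<close>

lemma rescaling_fps_nth_nonneg:
  assumes "0 \<le> a" "a \<le> 1" "N + i + 1 \<le> p"
  shows "0 \<le> rescaling_fps a p i $ N"
  using assms(3)
proof (induction i arbitrary: N p)
  case 0
  then obtain r where p: "p = Suc r" "N \<le> r" by (cases p) auto
  have "rescaling_fps a p 0 $ N = real (r + N choose N) - 2 * a * (if N = 0 then 0 else real (r + (N - 1) choose (N - 1)))"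
    by (simp add: rescaling_fps_def fps_mult_one_minus_const_X_nth p geometric_fps_power_nth del: power_Suc)
  moreover have "2 * a * (if N = 0 then 0 else real (r + (N - 1) choose (N - 1))) \<le> real (r + N choose N)"
  proof (cases N)
    case (Suc M)
    have "2 * a * real (r + M choose M) * real (Suc M) \<le> 2 * real (r + M choose M) * real (Suc M)"
      using assms by (intro mult_right_mono) auto
    \<comment> \<open>The comparison \<open>2 (M + 1) <= r + M + 1\<close> is exactly
      \<open>N <= r\<close>.\<close>
    also have "\<dots> \<le> real (Suc (r + M)) * real (r + M choose M)"
      unfolding mult.assoc mult.left_commute[of 2] mult.commute[of "real (r + M choose M)"]
      unfolding mult.assoc[symmetric] using p Suc by (intro mult_right_mono) auto
    also have "\<dots> = real (Suc (r + M) choose Suc M) * real (Suc M)"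
      by (simp only: Suc_times_binomial_eq flip: of_nat_mult)
    finally show ?thesis using Suc by simp
  qed simp
  ultimately show ?case by simp
next
  case (Suc i)
  then obtain r where p: "p = Suc r" by (cases p) auto
  have split: "1 - fps_const a * fps_X = (1 - fps_X) + fps_const (1 - a) * fps_X"
    by (simp add: algebra_simps flip: fps_const_sub)
  have "geometric_fps ^ p * (1 - fps_const a * fps_X) = geometric_fps ^ r + fps_const (1 - a) * (fps_X * geometric_fps ^ p)"
  proof -
    have "geometric_fps ^ p * ((1 - fps_X) + fps_const (1 - a) * fps_X)
      = geometric_fps ^ r * ((1 - fps_X) * geometric_fps) + fps_const (1 - a) * (fps_X * geometric_fps ^ p)"
      unfolding p by (simp add: algebra_simps)
    then show ?thesis unfolding split one_minus_X_mult_geometric_fps by simp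
  qed
  then have "rescaling_fps a p (Suc i)
    = rescaling_fps a r i + fps_const (1 - a) * (fps_X * rescaling_fps a p i)"
    unfolding rescaling_fps_def by (simp only: power_Suc mult.assoc[symmetric]) (simp add: algebra_simps)
  then have "rescaling_fps a p (Suc i) $ N
    = rescaling_fps a r i $ N + (1 - a) * (if N = 0 then 0 else rescaling_fps a p i $ (N - 1))"
    by (simp add: fps_X_mult_nth)
  moreover have "0 \<le> rescaling_fps a r i $ N" using Suc p by auto
  moreover have "0 \<le> (1 - a) * (if N = 0 then 0 else rescaling_fps a p i $ (N - 1))"
    using Suc assms by auto
  ultimately show ?case by simp
qed

text \<open>The polynomial factor has coefficient
  \<open>(-a)^j ((i choose j) + 2 (i choose (j-1)))\<close> at \<open>z^j\<close>, where the second
  binomial is absent for \<open>j = 0\<close>. Absorption puts this into a form containing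
  \<open>Suc i choose j\<close>, the binomial of the inversion formula.\<close>

lemma rescaling_fps_nth:
  "rescaling_fps a (Suc n) i $ N
    = (\<Sum>j\<le>N. (- a) ^ j * (real (Suc i choose j) * (real i + real j + 1) / (real i + 1)) * real (n + (N - j) choose (N - j)))"
proof -
  have "real (Suc i) * (((1 - fps_const a * fps_X) ^ i * (1 - fps_const (2 * a) * fps_X)) $ j)
      = (- a) ^ j * (real (Suc i choose j) * (real i + real j + 1))" for j
  proof (cases j)
    case (Suc k)
    have "real (Suc i) * (((1 - fps_const a * fps_X) ^ i * (1 - fps_const (2 * a) * fps_X)) $ j)
      = (- a) ^ j * (real (Suc i) * (real (i choose Suc k) + 2 * real (i choose k)))"
      unfolding fps_mult_one_minus_const_X_nth one_minus_const_X_power_nth Suc by (simp add: algebra_simps)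
    also have "real (Suc i) * (real (i choose Suc k) + 2 * real (i choose k))
      = real (Suc i) * real (Suc i choose Suc k) + real (Suc i) * real (i choose k)"
      by (simp add: algebra_simps)
    also have "real (Suc i) * real (i choose k) = real (Suc i choose Suc k) * real (Suc k)"
      by (simp only: Suc_times_binomial_eq flip: of_nat_mult)
    finally show ?thesis by (simp add: Suc algebra_simps)
  qed (simp add: fps_mult_one_minus_const_X_nth one_minus_const_X_power_nth)
  then have *: "((1 - fps_const a * fps_X) ^ i * (1 - fps_const (2 * a) * fps_X)) $ j
      = (- a) ^ j * (real (Suc i choose j) * (real i + real j + 1) / (real i + 1))" for j
    by (simp add: field_simps del: binomial_Suc_Suc)
  show ?thesis
    unfolding rescaling_fps_def mult.commute[of "geometric_fps ^ Suc n"] 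
    by (subst fps_mult_nth) (simp only: * geometric_fps_power_nth atLeast0AtMost)
qed

section \<open>Rescaled Bessel polynomials in the Bessel basis\<close>

definition rescaling_coeff :: "real \<Rightarrow> nat \<Rightarrow> nat \<Rightarrow> real" where
  "rescaling_coeff a n i = (\<Sum>k\<le>n. bessel_coeff n k * a ^ k * carlitz_coeff k i)"

lemma bessel_poly_pcompose_scale:
  "pcompose (bessel_poly n) [:0, a:] = (\<Sum>k\<le>n. smult (bessel_coeff n k * a ^ k) (monom 1 k))"
proof -
  have l: "[:0, a:] = monom a (Suc 0)" by (simp add: monom_Suc monom_0)
  have "pcompose (monom c k) [:0, a:] = smult (c * a ^ k) (monom 1 k)" for c k
    by (rule poly_eqI) (auto simp: l)
  then show ?thesis
    by (simp add: bessel_poly_def pcompose_sum atLeast0AtMost)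
qed

lemma smult_sum_right: "smult c (\<Sum>i\<in>A. f i) = (\<Sum>i\<in>A. smult c (f i))"
  by (rule sum_comp_morphism[symmetric, unfolded o_def]) (auto simp: smult_add_right)

lemma bessel_poly_rescale:
  "pcompose (bessel_poly n) [:0, a:] = (\<Sum>i\<le>n. smult (rescaling_coeff a n i) (bessel_poly i))"
proof -
  have "monom 1 k = (\<Sum>i\<le>n. smult (carlitz_coeff k i) (bessel_poly i))" if "k \<le> n" for k
    unfolding monom_eq_sum_bessel_poly
    using that by (intro sum.mono_neutral_left) (auto simp: carlitz_coeff_eq_0)
  then have "pcompose (bessel_poly n) [:0, a:]
     = (\<Sum>k\<le>n. \<Sum>i\<le>n. smult (bessel_coeff n k * a ^ k * carlitz_coeff k i) (bessel_poly i))"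
    unfolding bessel_poly_pcompose_scale
    by (intro sum.cong refl) (simp add: smult_sum_right)
  also have "\<dots> = (\<Sum>i\<le>n. smult (rescaling_coeff a n i) (bessel_poly i))"
    by (subst sum.swap) (simp add: rescaling_coeff_def smult_sum)
  finally show ?thesis .
qed

text \<open>With \<open>k = i + j\<close> the alternating sum becomes a Cauchy product, so its sign
  is that of a single power series coefficient: the prefactor is nonnegative for
  \<open>a >= 0\<close>.\<close>

lemma rescaling_coeff_eq:
  assumes "i \<le> n"
  shows "rescaling_coeff a n i = fact n * fact n / fact (2 * n) * (fact (2 * i) / (fact i * fact i)) * a ^ i
     * rescaling_fps a (Suc n) i $ (n - i)"
proof -
  obtain N where n: "n = i + N" using assms le_Suc_ex by blast
  have "rescaling_coeff a n i = (\<Sum>k\<in>{i..n}. bessel_coeff n k * a ^ k * carlitz_coeff k i)"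
    unfolding rescaling_coeff_def
    by (rule sum.mono_neutral_right) (auto simp: carlitz_coeff_eq_0)
  also have "\<dots> = (\<Sum>j\<le>N. bessel_coeff n (i + j) * a ^ (i + j) * carlitz_coeff (i + j) i)"
    by (rule sum.reindex_bij_witness[of _ "\<lambda>j. i + j" "\<lambda>k. k - i"]) (auto simp: n)
  also have "\<dots> = (\<Sum>j\<le>N. fact n * fact n / fact (2 * n) * (fact (2 * i) / (fact i * fact i)) * a ^ i
     * ((- a) ^ j * (real (Suc i choose j) * (real i + real j + 1) / (real i + 1)) * real (n + (N - j) choose (N - j))))"
  proof (rule sum.cong[OF refl])
    fix j assume "j \<in> {..N}"
    then obtain M where N: "N = j + M" using le_Suc_ex by auto
    have sub: "2 * n - (i + j) = n + M" "n - (i + j) = M" "N - j = M" by (auto simp: n N)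
    have binom: "fact (n + M) = real (n + M choose M) * (fact M * fact n)"
      by (simp add: binomial_fact)
    have "bessel_coeff n (i + j) = fact n * (real (n + M choose M) * fact n) * 2 ^ (i + j) / (fact (2 * n) * fact (i + j))"
      unfolding bessel_coeff_def sub binom by simp
    moreover have "carlitz_coeff (i + j) i = (- 1) ^ j * real (Suc i choose j) * ((real i + real j + 1) * fact (i + j)) / 2 ^ (i + j)
     * fact (2 * i) / (fact i * ((real i + 1) * fact i))"
      unfolding carlitz_coeff_add by (simp add: algebra_simps)
    \<comment> \<open>\<open>P\<close> is \<open>2^(i+j)\<close> and \<open>Q\<close> is
      \<open>(i+j)!\<close>; both cancel between the Bessel coefficient and the inversion
      coefficient.\<close>
    moreover have "fact n * (C * fact n) * P / (F * Q) * (U * A) * (E * B * (R * Q) / P * G / (H * (S * H)))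
       = fact n * fact n / F * (G / (H * H)) * U * (A * E * (B * R / S) * C)"
       if "P \<noteq> 0" "Q \<noteq> 0" for A B C E F G H P Q R S U :: real
      using that by (simp add: field_simps)
    ultimately show "bessel_coeff n (i + j) * a ^ (i + j) * carlitz_coeff (i + j) i
      = fact n * fact n / fact (2 * n) * (fact (2 * i) / (fact i * fact i)) * a ^ i
     * ((- a) ^ j * (real (Suc i choose j) * (real i + real j + 1) / (real i + 1)) * real (n + (N - j) choose (N - j)))"
      by (simp only: sub power_add[of a] power_minus[of a] power_one_right mult.commute[of _ "a ^ j"]) (simp add: mult_ac)
  qed
  finally show ?thesis
    unfolding rescaling_fps_nth sum_distrib_left by (simp add: n)
qed

lemma rescaling_coeff_nonneg:
  assumes "0 \<le> a" "a \<le> 1" "i \<le> n"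
  shows "0 \<le> rescaling_coeff a n i"
  unfolding rescaling_coeff_eq[OF assms(3)]
  using assms by (intro mult_nonneg_nonneg divide_nonneg_nonneg rescaling_fps_nth_nonneg) auto

subsection \<open>Products of rescaled Bessel polynomials\<close>

definition bessel_product :: "nat \<Rightarrow> nat \<Rightarrow> real \<Rightarrow> real poly" where
  "bessel_product n m a = pcompose (bessel_poly n) [:0, a:] * pcompose (bessel_poly m) [:0, 1 - a:]"

lemma bessel_product_expansion_iff:
  "bessel_product_expansion n m a \<beta> \<longleftrightarrow>
    bessel_product n m a = (\<Sum>k=min n m..n + m. smult (\<beta> k) (bessel_poly k))"
  by (simp add: bessel_product_expansion_def bessel_product_def)

lemma bessel_product_swap: "bessel_product n m a = bessel_product m n (1 - a)"
  by (simp add: bessel_product_def mult.commute)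

lemma poly_bessel_product:
  "poly (bessel_product n m a) u = poly (bessel_poly n) (a * u) * poly (bessel_poly m) ((1 - a) * u)"
  by (simp add: bessel_product_def poly_pcompose mult.commute)

text \<open>Let \<open>K\<close> be the largest index with nonzero coefficient. As
  \<open>q_j\<close> has degree exactly \<open>j\<close>, only \<open>q_K\<close> contributes to
  \<open>u^K\<close>.\<close>

lemma bessel_poly_independent:
  assumes "finite A" "(\<Sum>k\<in>A. smult (c k) (bessel_poly k)) = 0" "k \<in> A"
  shows "c k = 0"
proof (rule ccontr)
  assume "c k \<noteq> 0"
  define K where "K = Max {k \<in> A. c k \<noteq> 0}"
  have K: "K \<in> A" "c K \<noteq> 0" "\<And>j. j \<in> A \<Longrightarrow> K < j \<Longrightarrow> c j = 0"
    using Max_in[of "{k \<in> A. c k \<noteq> 0}"] Max_ge[of "{k \<in> A. c k \<noteq> 0}"] assms \<open>c k \<noteq> 0\<close>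
    unfolding K_def by fastforce+
  have "0 = (\<Sum>j\<in>A. c j * coeff (bessel_poly j) K)"
    using arg_cong[OF assms(2), of "\<lambda>p. coeff p K"] by (simp add: coeff_sum)
  also have "\<dots> = (\<Sum>j\<in>{K}. c j * coeff (bessel_poly j) K)"
    using assms(1) K by (intro sum.mono_neutral_right) (auto simp: coeff_bessel_poly not_less_iff_gr_or_eq not_le)
  finally show False
    using K bessel_coeff_pos[of K K] by (simp add: coeff_bessel_poly)
qed

text \<open>In the product rule the undifferentiated parts carry the weights \<open>a\<close> and
  \<open>1 - a\<close>, which add up to the product itself. Only the two terms of lower index
  survive.\<close>

lemma bessel_product_deriv:
  "pderiv (bessel_product (Suc n) (Suc m) a) - bessel_product (Suc n) (Suc m) a
    = - pCons 0 (smult (a\<^sup>2 / (2 * real n + 1)) (bessel_product n (Suc m) a)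
      + smult ((1 - a)\<^sup>2 / (2 * real m + 1)) (bessel_product (Suc n) m a))"
proof -
  \<comment> \<open>In \<open>a^2\<close> one factor comes from the chain rule and the other from
    the argument \<open>a u\<close> in the factor \<open>u\<close> of the derivative rule.\<close>
  have d: "pderiv (pcompose (bessel_poly (Suc n)) [:0, a:])
    = smult a (pcompose (bessel_poly (Suc n)) [:0, a:]) - smult (a\<^sup>2 / (2 * real n + 1)) (pCons 0 (pcompose (bessel_poly n) [:0, a:]))"
    for n and a :: real
  proof -
    have "pderiv (bessel_poly (Suc n)) = bessel_poly (Suc n) - smult (1 / (2 * real n + 1)) (pCons 0 (bessel_poly n))"
      using bessel_poly_deriv[of n] by (simp add: algebra_simps)
    then show ?thesis
      by (simp add: pderiv_pcompose pcompose_diff pcompose_smult pcompose_pCons pderiv_pCons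
          smult_diff_right power2_eq_square)
  qed
  show ?thesis
    unfolding bessel_product_def pderiv_mult d
    by (simp add: algebra_simps smult_diff_left smult_add_right)
qed

lemma pderiv_sum_poly: "pderiv (\<Sum>i\<in>A. f i) = (\<Sum>i\<in>A. pderiv (f i))"
  by (rule sum_comp_morphism[symmetric, unfolded o_def]) (auto simp: pderiv_add)

text \<open>The sum runs over all \<open>k <= n + m\<close>, with zeros below
  \<open>min n m\<close>, so that the two induction hypotheses share one index range and can be
  added termwise.\<close>

lemma bessel_product_nonneg_expansion:
  assumes "0 \<le> a" "a \<le> 1"
  shows "\<exists>\<beta>. (\<forall>k. 0 \<le> \<beta> k) \<and> (\<forall>k. k < min n m \<longrightarrow> \<beta> k = 0)
    \<and> bessel_product n m a = (\<Sum>k\<le>n + m. smult (\<beta> k) (bessel_poly k))"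
proof -
  \<comment> \<open>When one index is zero, that factor is 1 and the rescaling coefficients apply.
    The parameter is generalised because the case \<open>n = 0\<close> is reached by swapping, with
    \<open>1 - a\<close> in place of \<open>a\<close>.\<close>
  have base: "\<exists>\<beta>. (\<forall>k. 0 \<le> \<beta> k) \<and> (\<forall>k. k < min n 0 \<longrightarrow> \<beta> k = 0)
    \<and> bessel_product n 0 a = (\<Sum>k\<le>n + 0. smult (\<beta> k) (bessel_poly k))"
    if "0 \<le> a" "a \<le> 1" for n a
  proof -
    define \<beta> where "\<beta> k = (if k \<le> n then rescaling_coeff a n k else 0)" for k
    have "bessel_product n 0 a = (\<Sum>k\<le>n + 0. smult (\<beta> k) (bessel_poly k))"
      by (simp add: bessel_product_def bessel_poly_0 pcompose_1 bessel_poly_rescale \<beta>_def)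
    moreover have "\<forall>k. 0 \<le> \<beta> k"
      using that by (simp add: \<beta>_def rescaling_coeff_nonneg)
    ultimately show ?thesis by auto
  qed
  show ?thesis
  proof (induction n arbitrary: m)
    case 0
    then show ?case using base[of "1 - a" m] assms by (subst bessel_product_swap) simp
  next
    case (Suc n)
    note outer = Suc
    show ?case
    proof (induction m)
      case 0
      then show ?case using base[of a "Suc n"] assms by simp
    next
      case (Suc m)
      obtain \<beta> where \<beta>: "\<And>k. 0 \<le> \<beta> k" "\<And>k. k < min n (Suc m) \<Longrightarrow> \<beta> k = 0"
        "bessel_product n (Suc m) a = (\<Sum>k\<le>n + Suc m. smult (\<beta> k) (bessel_poly k))"
        using outer[of "Suc m"] by blast
      obtain \<gamma> where \<gamma>: "\<And>k. 0 \<le> \<gamma> k" "\<And>k. k < min (Suc n) m \<Longrightarrow> \<gamma> k = 0"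
        "bessel_product (Suc n) m a = (\<Sum>k\<le>Suc n + m. smult (\<gamma> k) (bessel_poly k))"
        using Suc by blast
      \<comment> \<open>The factor \<open>2k + 1\<close> compensates the denominator in
        \<open>q_(k+1)' - q_(k+1) = - u q_k / (2k+1)\<close>. The shift by one raises the first
        possibly nonzero index to \<open>min (Suc n) (Suc m)\<close>.\<close>
      define \<delta> where "\<delta> k = (case k of 0 \<Rightarrow> 0 | Suc k \<Rightarrow> (2 * real k + 1) *
        (a\<^sup>2 / (2 * real n + 1) * \<beta> k + (1 - a)\<^sup>2 / (2 * real m + 1) * \<gamma> k))" for k
      define D where "D = bessel_product (Suc n) (Suc m) a - (\<Sum>k\<le>Suc n + Suc m. smult (\<delta> k) (bessel_poly k))"
      have "pderiv (\<Sum>k\<le>Suc n + Suc m. smult (\<delta> k) (bessel_poly k)) - (\<Sum>k\<le>Suc n + Suc m. smult (\<delta> k) (bessel_poly k))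
        = (\<Sum>k\<le>Suc n + m. smult (\<delta> (Suc k)) (pderiv (bessel_poly (Suc k)) - bessel_poly (Suc k)))"
        unfolding add_Suc_right sum.atMost_Suc_shift
        by (simp add: \<delta>_def pderiv_sum_poly pderiv_smult smult_diff_right sum_subtractf
            del: sum.atMost_Suc)
      also have "\<dots> = - pCons 0 (\<Sum>k\<le>Suc n + m. smult (a\<^sup>2 / (2 * real n + 1) * \<beta> k + (1 - a)\<^sup>2 / (2 * real m + 1) * \<gamma> k) (bessel_poly k))"
      proof -
        have "(2 * real k + 1) * c * (- 1 / (2 * real k + 1)) = - c" for c k
          by (simp add: divide_simps)
        then show ?thesis
          unfolding bessel_poly_deriv pCons_0_sum sum_negf[symmetric] \<delta>_def
          by (intro sum.cong refl) (simp only: nat.case smult_smult smult_minus_left, simp)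
      qed
      also have "\<dots> = pderiv (bessel_product (Suc n) (Suc m) a) - bessel_product (Suc n) (Suc m) a"
        unfolding bessel_product_deriv \<beta>(3) \<gamma>(3)
        by (simp add: smult_sum_right smult_add_left sum.distrib del: sum.atMost_Suc)
      finally have "pderiv D = D"
        unfolding D_def by (simp add: pderiv_diff algebra_simps)
      then have "D = 0" by (rule pderiv_eq_self_imp_0)
      moreover have "\<forall>k. 0 \<le> \<delta> k"
        using \<beta>(1) \<gamma>(1) by (auto simp: \<delta>_def split: nat.split)
      moreover have "\<forall>k. k < min (Suc n) (Suc m) \<longrightarrow> \<delta> k = 0"
        using \<beta>(2) \<gamma>(2) by (auto simp: \<delta>_def split: nat.split)
      ultimately show ?case unfolding D_def by (intro exI[of _ \<delta>]) simp
    qed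
  qed
qed

section \<open>Uniqueness, existence, sign and sum of the coefficients\<close>

lemma bessel_product_expansion_unique:
  assumes "bessel_product_expansion n m a \<beta>" "bessel_product_expansion n m a \<gamma>" "k \<in> {min n m..n + m}"
  shows "\<beta> k = \<gamma> k"
proof -
  have "(\<Sum>k=min n m..n + m. smult (\<beta> k - \<gamma> k) (bessel_poly k)) = 0"
    using assms(1,2) by (simp add: bessel_product_expansion_iff smult_diff_left sum_subtractf)
  from bessel_poly_independent[OF _ this assms(3)] show ?thesis by simp
qed

lemma bessel_product_expansion_exists:
  assumes "0 \<le> a" "a \<le> 1"
  obtains \<beta> where "bessel_product_expansion n m a \<beta>" "\<And>k. 0 \<le> \<beta> k" "\<And>k. k \<notin> {min n m..n + m} \<Longrightarrow> \<beta> k = 0"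
proof -
  obtain \<beta> where \<beta>: "\<And>k. 0 \<le> \<beta> k" "\<And>k. k < min n m \<Longrightarrow> \<beta> k = 0"
    "bessel_product n m a = (\<Sum>k\<le>n + m. smult (\<beta> k) (bessel_poly k))"
    using bessel_product_nonneg_expansion[OF assms, of n m] by blast
  define \<gamma> where "\<gamma> k = (if k \<in> {min n m..n + m} then \<beta> k else 0)" for k
  have "bessel_product n m a = (\<Sum>k=min n m..n + m. smult (\<gamma> k) (bessel_poly k))"
    unfolding \<beta>(3) by (rule sum.mono_neutral_cong_right) (auto simp: \<gamma>_def not_le \<beta>(2))
  with \<beta>(1) show thesis
    by (intro that[of \<gamma>]) (auto simp: bessel_product_expansion_iff \<gamma>_def)
qed

lemma bessel_product_expansion_nonneg:
  assumes "0 \<le> a" "a \<le> 1" "bessel_product_expansion n m a \<beta>" "k \<in> {min n m..n + m}"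
  shows "0 \<le> \<beta> k"
  using assms bessel_product_expansion_exists[of a n m] bessel_product_expansion_unique by metis

lemma bessel_product_expansion_poly:
  assumes "bessel_product_expansion n m a \<beta>"
  shows "poly (bessel_poly n) (a * u) * poly (bessel_poly m) ((1 - a) * u)
    = (\<Sum>k=min n m..n + m. \<beta> k * poly (bessel_poly k) u)"
  using assms by (simp add: bessel_product_expansion_iff poly_sum flip: poly_bessel_product)

lemma poly_bessel_poly_0: "poly (bessel_poly n) 0 = 1"
  by (simp add: poly_0_coeff_0 coeff_bessel_poly)

text \<open>At \<open>u = 0\<close> every Bessel polynomial takes the value 1.\<close>

lemma bessel_product_expansion_sum:
  assumes "bessel_product_expansion n m a \<beta>"
  shows "(\<Sum>k=min n m..n + m. \<beta> k) = 1"
  using bessel_product_expansion_poly[OF assms, of 0] by (simp add: poly_bessel_poly_0)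

subsection \<open>Cosine transforms of powers of the Cauchy density\<close>

text \<open>The integrable function \<open>w\<close> dominates all difference quotients at
  \<open>t\<close>, so dominated convergence applies along every sequence tending to
  \<open>t\<close>.\<close>

lemma has_field_derivative_lebesgue_integral:
  fixes f :: "real \<Rightarrow> 'a \<Rightarrow> real"
  assumes int: "\<And>s. integrable M (f s)"
    and deriv: "\<And>x. ((\<lambda>s. f s x) has_field_derivative f' x) (at t)"
    and [measurable]: "f' \<in> borel_measurable M"
    and w: "integrable M w" "\<And>s x. \<bar>f s x - f t x\<bar> \<le> \<bar>s - t\<bar> * w x"
  shows "((\<lambda>s. \<integral>x. f s x \<partial>M) has_field_derivative (\<integral>x. f' x \<partial>M)) (at t)"
  unfolding has_field_derivative_iff tendsto_at_iff_sequentially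
proof (intro allI impI)
  fix X :: "nat \<Rightarrow> real"
  assume X: "\<forall>i. X i \<in> UNIV - {t}" "X \<longlonglongrightarrow> t"
  have [measurable]: "f s \<in> borel_measurable M" for s using int by blast
  have "(\<lambda>i. \<integral>x. (f (X i) x - f t x) / (X i - t) \<partial>M) \<longlonglongrightarrow> (\<integral>x. f' x \<partial>M)"
  proof (rule integral_dominated_convergence)
    show "integrable M w" by (rule w)
    show "AE x in M. (\<lambda>i. (f (X i) x - f t x) / (X i - t)) \<longlonglongrightarrow> f' x"
      using deriv X unfolding has_field_derivative_iff tendsto_at_iff_sequentially
      by (auto simp: o_def)
    show "AE x in M. norm ((f (X i) x - f t x) / (X i - t)) \<le> w x" for i
    proof (rule AE_I2)
      fix x
      show "norm ((f (X i) x - f t x) / (X i - t)) \<le> w x"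
        using w(2)[of "X i" x] X(1) by (simp add: abs_divide divide_simps mult.commute)
    qed
  qed measurable
  then show "((\<lambda>y. ((\<integral>x. f y x \<partial>M) - (\<integral>x. f t x \<partial>M)) / (y - t)) \<circ> X) \<longlonglongrightarrow> (\<integral>x. f' x \<partial>M)"
    using int by (simp add: o_def)
qed

section \<open>Cosine and sine transforms and their derivatives\<close>

definition cos_transform :: "(real \<Rightarrow> real) \<Rightarrow> real \<Rightarrow> real" where
  "cos_transform g t = (\<integral>x. cos (t * x) * g x \<partial>lborel)"

definition sin_transform :: "(real \<Rightarrow> real) \<Rightarrow> real \<Rightarrow> real" where
  "sin_transform g t = (\<integral>x. sin (t * x) * g x \<partial>lborel)"

lemma integrable_mult_bounded_real:
  fixes g b :: "'a \<Rightarrow> real"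
  assumes "integrable M g" "b \<in> borel_measurable M" "\<And>x. \<bar>b x\<bar> \<le> 1"
  shows "integrable M (\<lambda>x. b x * g x)"
  using assms(1)
proof (rule Bochner_Integration.integrable_bound)
  show "(\<lambda>x. b x * g x) \<in> borel_measurable M" using assms by measurable
  show "AE x in M. norm (b x * g x) \<le> norm (g x)"
    using assms(3) by (auto simp: abs_mult intro!: mult_left_le_one_le)
qed

lemma integrable_cos_mult: "integrable lborel g \<Longrightarrow> integrable lborel (\<lambda>x. cos (t * x) * g x :: real)"
  and integrable_sin_mult: "integrable lborel g \<Longrightarrow> integrable lborel (\<lambda>x. sin (t * x) * g x :: real)"
  by (intro integrable_mult_bounded_real; simp)+

lemma abs_cos_diff_le: "\<bar>cos a - cos b\<bar> \<le> \<bar>a - b :: real\<bar>"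
  and abs_sin_diff_le: "\<bar>sin a - sin b\<bar> \<le> \<bar>a - b :: real\<bar>"
proof -
  have "\<bar>cos a - cos b\<bar> = 2 * \<bar>sin ((a + b) / 2)\<bar> * \<bar>sin ((b - a) / 2)\<bar>"
    by (simp add: cos_diff_cos abs_mult)
  also have "\<dots> \<le> 2 * 1 * \<bar>(b - a) / 2\<bar>"
    by (intro mult_mono abs_sin_x_le_abs_x) auto
  finally show "\<bar>cos a - cos b\<bar> \<le> \<bar>a - b\<bar>" by simp
  have "\<bar>sin a - sin b\<bar> = 2 * \<bar>sin ((a - b) / 2)\<bar> * \<bar>cos ((a + b) / 2)\<bar>"
    by (simp add: sin_diff_sin abs_mult)
  also have "\<dots> \<le> 2 * \<bar>(a - b) / 2\<bar> * 1"
    by (intro mult_mono abs_sin_x_le_abs_x) auto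
  finally show "\<bar>sin a - sin b\<bar> \<le> \<bar>a - b\<bar>" by simp
qed

text \<open>Cosine is 1-Lipschitz, so \<open>\<bar>x * g x\<bar>\<close> dominates the difference
  quotients; the sine transform is treated alike.\<close>

lemma cos_transform_deriv:
  assumes g: "integrable lborel g" and xg: "integrable lborel (\<lambda>x. x * g x)"
  shows "(cos_transform g has_field_derivative - sin_transform (\<lambda>x. x * g x) t) (at t)"
proof -
  have [measurable]: "g \<in> borel_measurable borel" using g by auto
  have "((\<lambda>s. \<integral>x. cos (s * x) * g x \<partial>lborel) has_field_derivative
     (\<integral>x. - (sin (t * x) * (x * g x)) \<partial>lborel)) (at t)"
  proof (rule has_field_derivative_lebesgue_integral)
    show "integrable lborel (\<lambda>x. cos (s * x) * g x)" for s using g by (rule integrable_cos_mult)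
    show "((\<lambda>s. cos (s * x) * g x) has_real_derivative - (sin (t * x) * (x * g x))) (at t)" for x
      by (auto intro!: derivative_eq_intros)
    show "integrable lborel (\<lambda>x. \<bar>x * g x\<bar>)" using xg by (rule integrable_abs)
    show "\<bar>cos (s * x) * g x - cos (t * x) * g x\<bar> \<le> \<bar>s - t\<bar> * \<bar>x * g x\<bar>" for s x
    proof -
      have "\<bar>cos (s * x) * g x - cos (t * x) * g x\<bar> = \<bar>cos (s * x) - cos (t * x)\<bar> * \<bar>g x\<bar>"
        by (simp add: abs_mult flip: left_diff_distrib)
      also have "\<dots> \<le> \<bar>s * x - t * x\<bar> * \<bar>g x\<bar>" by (intro mult_right_mono abs_cos_diff_le) auto
      finally show ?thesis by (simp add: abs_mult mult.assoc flip: left_diff_distrib)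
    qed
  qed measurable
  then show ?thesis
    by (simp add: sin_transform_def cos_transform_def[abs_def])
qed

lemma sin_transform_deriv:
  assumes g: "integrable lborel g" and xg: "integrable lborel (\<lambda>x. x * g x)"
  shows "(sin_transform g has_field_derivative cos_transform (\<lambda>x. x * g x) t) (at t)"
proof -
  have [measurable]: "g \<in> borel_measurable borel" using g by auto
  have "((\<lambda>s. \<integral>x. sin (s * x) * g x \<partial>lborel) has_field_derivative
     (\<integral>x. cos (t * x) * (x * g x) \<partial>lborel)) (at t)"
  proof (rule has_field_derivative_lebesgue_integral)
    show "integrable lborel (\<lambda>x. sin (s * x) * g x)" for s using g by (rule integrable_sin_mult)
    show "((\<lambda>s. sin (s * x) * g x) has_real_derivative cos (t * x) * (x * g x)) (at t)" for x
      by (auto intro!: derivative_eq_intros)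
    show "integrable lborel (\<lambda>x. \<bar>x * g x\<bar>)" using xg by (rule integrable_abs)
    show "\<bar>sin (s * x) * g x - sin (t * x) * g x\<bar> \<le> \<bar>s - t\<bar> * \<bar>x * g x\<bar>" for s x
    proof -
      have "\<bar>sin (s * x) * g x - sin (t * x) * g x\<bar> = \<bar>sin (s * x) - sin (t * x)\<bar> * \<bar>g x\<bar>"
        by (simp add: abs_mult flip: left_diff_distrib)
      also have "\<dots> \<le> \<bar>s * x - t * x\<bar> * \<bar>g x\<bar>" by (intro mult_right_mono abs_sin_diff_le) auto
      finally show ?thesis by (simp add: abs_mult mult.assoc flip: left_diff_distrib)
    qed
  qed measurable
  then show ?thesis
    by (simp add: cos_transform_def sin_transform_def[abs_def])
qed

text \<open>Applied to products, this is integration by parts on the whole line without boundary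
  terms; the recursions below come from it.\<close>

lemma integral_derivative_eq_0:
  fixes F f :: "real \<Rightarrow> real"
  assumes "\<And>x. (F has_field_derivative f x) (at x)" "\<And>x. isCont f x" "integrable lborel f"
    "(F \<longlongrightarrow> 0) at_top" "(F \<longlongrightarrow> 0) at_bot"
  shows "(\<integral>x. f x \<partial>lborel) = 0"
proof -
  have "einterval (-\<infinity>) \<infinity> = UNIV" by (auto simp: einterval_def)
  moreover have "(LBINT x=-\<infinity>..\<infinity>. f x) = 0 - 0"
    by (rule interval_integral_FTC_integrable[where F = F])
       (use assms in \<open>auto simp: has_real_derivative_iff_has_vector_derivative[symmetric]
          ereal_tendsto_simps set_integrable_def calculation\<close>)
  ultimately show ?thesis
    by (simp add: interval_lebesgue_integral_def set_lebesgue_integral_def)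
qed

section \<open>Powers of the Cauchy density: decay, integrability, recursions\<close>

definition cauchy_power :: "nat \<Rightarrow> real \<Rightarrow> real" where
  "cauchy_power n x = 1 / (1 + x\<^sup>2) ^ n"

lemma one_plus_square_pos: "0 < 1 + (x::real)\<^sup>2"
  by (simp add: add_pos_nonneg)

lemma measurable_cauchy_power [measurable]: "cauchy_power n \<in> borel_measurable borel"
  unfolding cauchy_power_def[abs_def] by measurable

lemma isCont_cauchy_power [continuous_intros]: "isCont (cauchy_power n) x"
  unfolding cauchy_power_def[abs_def] using one_plus_square_pos[of x] by (intro continuous_intros) auto

lemma cauchy_power_pos: "0 < cauchy_power n x"
  using one_plus_square_pos[of x] by (simp add: cauchy_power_def)

lemma cauchy_power_antimono: "m \<le> n \<Longrightarrow> cauchy_power n x \<le> cauchy_power m x"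
  unfolding cauchy_power_def
  by (intro divide_left_mono power_increasing) (auto simp: one_plus_square_pos)

lemma cauchy_power_Suc: "(1 + x\<^sup>2) * cauchy_power (Suc n) x = cauchy_power n x"
  using one_plus_square_pos[of x] by (simp add: cauchy_power_def)

lemma cauchy_power_deriv:
  "(cauchy_power n has_field_derivative - 2 * real n * x * cauchy_power (Suc n) x) (at x)"
proof (cases n)
  case 0
  then show ?thesis by (simp add: cauchy_power_def[abs_def])
next
  case (Suc m)
  have eq: "cauchy_power k = (\<lambda>x. inverse (1 + x\<^sup>2) ^ k)" for k
    by (simp add: cauchy_power_def[abs_def] inverse_eq_divide power_divide)
  have "((\<lambda>x. inverse (1 + x\<^sup>2)) has_field_derivative - 2 * x * inverse (1 + x\<^sup>2) ^ 2) (at x)"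
    using one_plus_square_pos[of x] by (auto intro!: derivative_eq_intros simp: power2_eq_square)
  from DERIV_power[OF this, of n] show ?thesis
    unfolding eq Suc by (simp add: power2_eq_square algebra_simps)
qed

lemma has_bochner_integral_cauchy: "has_bochner_integral lborel (cauchy_power 1) pi"
proof -
  have "einterval (-\<infinity>) \<infinity> = UNIV" by (auto simp: einterval_def)
  then show ?thesis
    using integrable_inverse_1_plus_square LBINT_inverse_1_plus_square
    by (simp add: has_bochner_integral_iff cauchy_power_def[abs_def] set_integrable_def
      interval_lebesgue_integral_def set_lebesgue_integral_def inverse_eq_divide)
qed

lemma integrable_cauchy_power: "integrable lborel (cauchy_power (Suc n))"
proof (rule Bochner_Integration.integrable_bound)
  show "integrable lborel (cauchy_power 1)"
    using has_bochner_integral_cauchy by (simp add: has_bochner_integral_iff)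
  show "AE x in lborel. norm (cauchy_power (Suc n) x) \<le> norm (cauchy_power 1 x)"
    using cauchy_power_antimono[of 1 "Suc n"] cauchy_power_pos by (auto simp: abs_of_pos)
qed simp

text \<open>The bound \<open>|x| <= 1 + x^2\<close> trades the factor \<open>x\<close> for one
  power. The exponent starts at 2 since \<open>x / (1 + x^2)\<close> is not integrable.\<close>

lemma integrable_x_cauchy_power: "integrable lborel (\<lambda>x. x * cauchy_power (Suc (Suc n)) x)"
proof (rule Bochner_Integration.integrable_bound)
  show "integrable lborel (cauchy_power (Suc n))" by (rule integrable_cauchy_power)
  have "\<bar>x\<bar> * cauchy_power (Suc (Suc n)) x \<le> cauchy_power (Suc n) x" for x
  proof -
    have "0 \<le> (\<bar>x\<bar> - 1)\<^sup>2" "0 \<le> x\<^sup>2" by simp_all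
    then have "\<bar>x\<bar> \<le> 1 + x\<^sup>2" by (simp add: power2_diff del: zero_le_power2)
    then show ?thesis
      unfolding cauchy_power_Suc[of x "Suc n", symmetric]
      using cauchy_power_pos by (intro mult_right_mono) (auto simp: less_imp_le)
  qed
  then show "AE x in lborel. norm (x * cauchy_power (Suc (Suc n)) x) \<le> norm (cauchy_power (Suc n) x)"
    using cauchy_power_pos by (auto simp: abs_mult abs_of_pos)
qed simp

lemma square_mult_cauchy_power:
  "x * (x * cauchy_power (Suc n) x) = cauchy_power n x - cauchy_power (Suc n) x"
  unfolding cauchy_power_Suc[of x n, symmetric] by (simp add: algebra_simps power2_eq_square)

text \<open>Both functions are bounded by \<open>1 / |x|\<close> in absolute value, which settles
  both ends at once through \<open>at_infinity\<close>.\<close>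

lemma cauchy_power_tendsto_0:
  "(cauchy_power (Suc n) \<longlongrightarrow> 0) at_top" "(cauchy_power (Suc n) \<longlongrightarrow> 0) at_bot"
  "((\<lambda>x. x * cauchy_power (Suc n) x) \<longlongrightarrow> 0) at_top" "((\<lambda>x. x * cauchy_power (Suc n) x) \<longlongrightarrow> 0) at_bot"
proof -
  have "((\<lambda>x. inverse x :: real) \<longlongrightarrow> 0) at_infinity" by (rule tendsto_inverse_0)
  then have lim: "((\<lambda>x. \<bar>inverse x\<bar> :: real) \<longlongrightarrow> 0) at_infinity" by (rule tendsto_rabs_zero)
  have b: "cauchy_power (Suc n) x \<le> \<bar>inverse x\<bar>" "\<bar>x\<bar> * cauchy_power (Suc n) x \<le> \<bar>inverse x\<bar>" if "x \<noteq> 0" for x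
  proof -
    have "0 \<le> (\<bar>x\<bar> - 1)\<^sup>2" "0 \<le> x\<^sup>2" by simp_all
    then have "\<bar>x\<bar> \<le> 1 + x\<^sup>2" by (simp add: power2_diff del: zero_le_power2)
    have c: "cauchy_power (Suc n) x \<le> 1 / (1 + x\<^sup>2)"
      using cauchy_power_antimono[of 1 "Suc n" x] by (simp add: cauchy_power_def)
    also have "\<dots> \<le> 1 / \<bar>x\<bar>"
      using that \<open>\<bar>x\<bar> \<le> 1 + x\<^sup>2\<close> by (intro divide_left_mono) auto
    finally show "cauchy_power (Suc n) x \<le> \<bar>inverse x\<bar>" by (simp add: inverse_eq_divide abs_divide)
    have "\<bar>x\<bar> * cauchy_power (Suc n) x \<le> \<bar>x\<bar> * (1 / (1 + x\<^sup>2))"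
      using c by (intro mult_left_mono) auto
    also have "\<dots> \<le> \<bar>inverse x\<bar>"
      using that one_plus_square_pos[of x]
      by (simp add: abs_inverse divide_simps) (simp add: power2_eq_square abs_mult_self_eq flip: abs_mult)
    finally show "\<bar>x\<bar> * cauchy_power (Suc n) x \<le> \<bar>inverse x\<bar>" .
  qed
  have "eventually (\<lambda>x. x \<noteq> (0::real)) at_infinity" by (rule eventually_not_equal_at_infinity)
  then have ev: "eventually (\<lambda>x. norm (cauchy_power (Suc n) x) \<le> \<bar>inverse x\<bar>) at_infinity"
    "eventually (\<lambda>x. norm (x * cauchy_power (Suc n) x) \<le> \<bar>inverse x\<bar>) at_infinity"
    using b by (auto elim!: eventually_mono simp: abs_mult abs_of_pos cauchy_power_pos simp del: abs_inverse)
  have "(cauchy_power (Suc n) \<longlongrightarrow> 0) at_infinity" "((\<lambda>x. x * cauchy_power (Suc n) x) \<longlongrightarrow> 0) at_infinity"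
    by (rule Lim_null_comparison[OF ev(1) lim] Lim_null_comparison[OF ev(2) lim])+
  then show "(cauchy_power (Suc n) \<longlongrightarrow> 0) at_top" "(cauchy_power (Suc n) \<longlongrightarrow> 0) at_bot"
    "((\<lambda>x. x * cauchy_power (Suc n) x) \<longlongrightarrow> 0) at_top" "((\<lambda>x. x * cauchy_power (Suc n) x) \<longlongrightarrow> 0) at_bot"
    by (auto intro: tendsto_mono[OF at_top_le_at_infinity] tendsto_mono[OF at_bot_le_at_infinity])
qed

text \<open>Integrate the derivative of \<open>x * cauchy_power (Suc n) x\<close> and replace
  \<open>x^2\<close> by \<open>(1 + x^2) - 1\<close>. The ratio obtained fixes the transforms at
  0.\<close>

lemma integral_cauchy_power_Suc:
  "(2 * real n + 2) * (\<integral>x. cauchy_power (Suc (Suc n)) x \<partial>lborel)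
     = (2 * real n + 1) * (\<integral>x. cauchy_power (Suc n) x \<partial>lborel)"
proof -
  have "(\<integral>x. (2 * real n + 2) * cauchy_power (Suc (Suc n)) x - (2 * real n + 1) * cauchy_power (Suc n) x \<partial>lborel) = 0"
  proof (rule integral_derivative_eq_0)
    fix x
    have "((\<lambda>x. x * cauchy_power (Suc n) x) has_field_derivative
       1 * cauchy_power (Suc n) x + - 2 * real (Suc n) * x * cauchy_power (Suc (Suc n)) x * x) (at x)"
      by (rule DERIV_mult DERIV_ident cauchy_power_deriv)+
    also have "1 * cauchy_power (Suc n) x + - 2 * real (Suc n) * x * cauchy_power (Suc (Suc n)) x * x
      = cauchy_power (Suc n) x - 2 * real (Suc n) * (x * (x * cauchy_power (Suc (Suc n)) x))"
      by (simp only: mult_ac)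
    also have "\<dots> = (2 * real n + 2) * cauchy_power (Suc (Suc n)) x - (2 * real n + 1) * cauchy_power (Suc n) x"
      unfolding square_mult_cauchy_power by (simp add: algebra_simps)
    finally show "((\<lambda>x. x * cauchy_power (Suc n) x) has_field_derivative
      (2 * real n + 2) * cauchy_power (Suc (Suc n)) x - (2 * real n + 1) * cauchy_power (Suc n) x) (at x)" .
  qed (intro continuous_intros Bochner_Integration.integrable_diff integrable_mult_right
      integrable_cauchy_power cauchy_power_tendsto_0 isCont_cauchy_power)+
  then show ?thesis
    by (simp add: integrable_cauchy_power)
qed

text \<open>Integrate the derivative of \<open>sin (t * x) * cauchy_power (Suc n) x\<close>.\<close>

lemma sin_transform_x_cauchy_power:
  "(2 * real n + 2) * sin_transform (\<lambda>x. x * cauchy_power (Suc (Suc n)) x) t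
    = t * cos_transform (cauchy_power (Suc n)) t"
proof -
  let ?c = "cauchy_power"
  have "(\<integral>x. t * (cos (t * x) * ?c (Suc n) x) - (2 * real n + 2) * (sin (t * x) * (x * ?c (Suc (Suc n)) x)) \<partial>lborel) = 0"
  proof (rule integral_derivative_eq_0)
    show "((\<lambda>x. sin (t * x) * ?c (Suc n) x) has_field_derivative
      t * (cos (t * x) * ?c (Suc n) x) - (2 * real n + 2) * (sin (t * x) * (x * ?c (Suc (Suc n)) x))) (at x)" for x
      by (auto intro!: derivative_eq_intros cauchy_power_deriv simp: algebra_simps)
    have *: "((\<lambda>x. sin (t * x) * ?c (Suc n) x) \<longlongrightarrow> 0) F" if "(?c (Suc n) \<longlongrightarrow> 0) F" for F
      using that by (rule Lim_null_comparison[rotated])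
        (auto simp: abs_mult abs_of_pos cauchy_power_pos intro!: always_eventually mult_left_le_one_le less_imp_le[OF cauchy_power_pos])
    show "((\<lambda>x. sin (t * x) * ?c (Suc n) x) \<longlongrightarrow> 0) at_top" "((\<lambda>x. sin (t * x) * ?c (Suc n) x) \<longlongrightarrow> 0) at_bot"
      by (intro * cauchy_power_tendsto_0)+
  qed (intro continuous_intros Bochner_Integration.integrable_diff integrable_mult_right
      integrable_cauchy_power integrable_x_cauchy_power integrable_cos_mult integrable_sin_mult isCont_cauchy_power)+
  then show ?thesis
    by (simp add: integrable_cauchy_power integrable_x_cauchy_power integrable_cos_mult integrable_sin_mult
       cos_transform_def sin_transform_def)
qed

text \<open>After normalisation this is the analytic counterpart of
  \<open>bessel_poly_deriv\<close>.\<close>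

lemma cos_transform_cauchy_power_deriv:
  "(cos_transform (cauchy_power (Suc (Suc n))) has_field_derivative
     - t / (2 * real n + 2) * cos_transform (cauchy_power (Suc n)) t) (at t)"
proof -
  have "- sin_transform (\<lambda>x. x * cauchy_power (Suc (Suc n)) x) t
    = - t / (2 * real n + 2) * cos_transform (cauchy_power (Suc n)) t"
    using sin_transform_x_cauchy_power[of n t] by (simp add: field_simps)
  with cos_transform_deriv[OF integrable_cauchy_power integrable_x_cauchy_power, of n t]
  show ?thesis by simp
qed

lemma cos_transform_0: "cos_transform g 0 = (\<integral>x. g x \<partial>lborel)"
  by (simp add: cos_transform_def)

lemma cos_transform_minus: "cos_transform g (- t) = cos_transform g t"
  by (simp add: cos_transform_def)

lemma abs_cos_transform_le:
  assumes "integrable lborel g" "\<And>x. 0 \<le> g x"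
  shows "\<bar>cos_transform g t\<bar> \<le> (\<integral>x. g x \<partial>lborel)"
proof -
  have "\<bar>cos_transform g t\<bar> \<le> (\<integral>x. \<bar>cos (t * x) * g x\<bar> \<partial>lborel)"
    unfolding cos_transform_def by (rule integral_abs_bound)
  also have "\<dots> \<le> (\<integral>x. g x \<partial>lborel)"
    using assms by (intro integral_mono integrable_abs integrable_cos_mult)
      (auto simp: abs_mult intro!: mult_left_le_one_le)
  finally show ?thesis .
qed

lemma isCont_lebesgue_integral:
  fixes f :: "real \<Rightarrow> 'a \<Rightarrow> real"
  assumes "\<And>x. isCont (\<lambda>s. f s x) t" "\<And>s. f s \<in> borel_measurable M"
    "integrable M w" "\<And>s x. \<bar>f s x\<bar> \<le> w x"
  shows "isCont (\<lambda>s. \<integral>x. f s x \<partial>M) t"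
  unfolding continuous_at_sequentially o_def
proof (intro allI impI)
  fix X assume "X \<longlonglongrightarrow> t"
  then show "(\<lambda>i. \<integral>x. f (X i) x \<partial>M) \<longlonglongrightarrow> (\<integral>x. f t x \<partial>M)"
    using assms by (intro integral_dominated_convergence[where w = w]) (auto simp: continuous_at_sequentially o_def)
qed

lemma isCont_cos_transform:
  assumes "integrable lborel g"
  shows "isCont (cos_transform g) t"
  unfolding cos_transform_def[abs_def]
proof (rule isCont_lebesgue_integral)
  show "integrable lborel (\<lambda>x. \<bar>g x\<bar>)" using assms by (rule integrable_abs)
qed (use assms in \<open>auto simp: abs_mult intro!: mult_left_le_one_le\<close>)

section \<open>The characteristic function of the Cauchy law\<close>

lemma has_real_derivative_0_eq_on_greaterThan:
  fixes f :: "real \<Rightarrow> real"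
  assumes "\<And>x. c < x \<Longrightarrow> (f has_field_derivative 0) (at x)" "c < x" "c < y"
  shows "f x = f y"
proof -
  have "\<exists>k. \<forall>x\<in>{c<..}. f x = k"
    by (rule has_field_derivative_zero_constant)
      (auto intro!: has_field_derivative_at_within assms(1))
  then show ?thesis using assms(2,3) by auto
qed

text \<open>The transform \<open>c0\<close> cannot be differentiated under the integral by
  \<open>cos_transform_deriv\<close>, because \<open>x * cauchy_power 1 x\<close> is not integrable.
  Its derivative is recovered from that of \<open>t * c0 t\<close>, a multiple of the derivative of
  \<open>c1\<close>.\<close>

lemma cos_transform_cauchy:
  assumes "0 \<le> t"
  shows "cos_transform (cauchy_power 1) t = pi * exp (- t)"
proof -
  define c0 where "c0 = cos_transform (cauchy_power 1)"
  define c1 where "c1 = cos_transform (cauchy_power 2)"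
  note numeral_2_eq_2 [simp]
  have d1: "(c1 has_field_derivative - t / 2 * c0 t) (at t)" for t
    using cos_transform_cauchy_power_deriv[of 0 t] by (simp add: c0_def c1_def)
  \<comment> \<open>The second moment of \<open>cauchy_power 2\<close> is finite, so
    \<open>c1\<close> can be differentiated twice.\<close>
  have int: "integrable lborel (\<lambda>x. x * (x * cauchy_power (Suc (Suc 0)) x))"
    unfolding square_mult_cauchy_power
    by (intro Bochner_Integration.integrable_diff integrable_cauchy_power)
  have "cos_transform (\<lambda>x. x * (x * cauchy_power (Suc (Suc 0)) x)) t = c0 t - c1 t" for t
    unfolding square_mult_cauchy_power
    by (simp add: cos_transform_def c0_def c1_def right_diff_distrib integrable_cos_mult integrable_cauchy_power)
  then have d2: "((\<lambda>t. - sin_transform (\<lambda>x. x * cauchy_power (Suc (Suc 0)) x) t) has_field_derivative c1 t - c0 t) (at t)" for t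
    using DERIV_minus[OF sin_transform_deriv[OF integrable_x_cauchy_power int, of t]] by simp
  have c1': "- sin_transform (\<lambda>x. x * cauchy_power (Suc (Suc 0)) x) t = - t / 2 * c0 t" for t
    using sin_transform_x_cauchy_power[of 0 t] by (simp add: c0_def)
  have d2: "((\<lambda>t. - t / 2 * c0 t) has_field_derivative c1 t - c0 t) (at t)" for t
    using d2[of t] unfolding c1' .
  \<comment> \<open>\<open>c0' = -w\<close> and \<open>w' = -c0\<close>, so \<open>c0 - w\<close> is a multiple of \<open>exp t\<close>; being bounded, it vanishes.\<close>
  define w where "w t = (2 * c1 t - c0 t) / t" for t
  have d0: "(c0 has_field_derivative - w t) (at t)" if "t > 0" for t
  proof -
    \<comment> \<open>\<open>u\<close> is the derivative of \<open>c1\<close>. Away from 0,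
      \<open>c0 s = - 2 * u s / s\<close>, which transfers differentiability from \<open>u\<close>
      to \<open>c0\<close>.\<close>
    define u where "u s = - s / 2 * c0 s" for s
    have du: "(u has_field_derivative c1 t - c0 t) (at t)"
      using d2[of t] by (simp add: u_def[abs_def])
    have "((\<lambda>s. - 2 * u s / s) has_field_derivative - w t) (at t)"
      using that by (auto intro!: derivative_eq_intros du simp: w_def)
        (simp add: u_def field_simps power2_eq_square)
    moreover have "\<forall>\<^sub>F s in nhds t. - 2 * u s / s = c0 s"
    proof -
      have "\<forall>\<^sub>F s in nhds t. s \<in> {0<..}" using that by (intro eventually_nhds_in_open) auto
      then show ?thesis by eventually_elim (simp add: u_def)
    qed
    ultimately show ?thesis by (simp cong: DERIV_cong_ev)
  qed
  have dw: "(w has_field_derivative - c0 t) (at t)" if "t > 0" for t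
    unfolding w_def[abs_def] using that
    by (auto intro!: derivative_eq_intros d0 d1 simp: w_def field_simps power2_eq_square)
  \<comment> \<open>For \<open>t >= 1\<close> the division by \<open>t\<close> does not enlarge
    \<open>w\<close>, so the total masses bound \<open>c0 - w\<close>.\<close>
  define B where "B = (\<integral>x. cauchy_power 1 x \<partial>lborel) + (2 * (\<integral>x. cauchy_power 2 x \<partial>lborel) + (\<integral>x. cauchy_power 1 x \<partial>lborel))"
  have bound: "\<bar>c0 t - w t\<bar> \<le> B" if "t \<ge> 1" for t
  proof -
    have b: "\<bar>c0 t\<bar> \<le> (\<integral>x. cauchy_power 1 x \<partial>lborel)" "\<bar>c1 t\<bar> \<le> (\<integral>x. cauchy_power 2 x \<partial>lborel)"
      unfolding c0_def c1_def
      by (intro abs_cos_transform_le; simp add: integrable_cauchy_power less_imp_le[OF cauchy_power_pos])+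
    have "\<bar>w t\<bar> \<le> \<bar>2 * c1 t - c0 t\<bar>"
      using that by (simp add: w_def abs_divide divide_le_eq mult_le_cancel_left1)
    with b show ?thesis unfolding B_def by linarith
  qed
  have cw: "c0 t = w t" if "t > 0" for t
  proof -
    have const: "(c0 s - w s) * exp (- s) = (c0 t - w t) * exp (- t)" if "s > 0" for s
    proof (rule has_real_derivative_0_eq_on_greaterThan[where c = 0 and f = "\<lambda>s. (c0 s - w s) * exp (- s)"])
      show "((\<lambda>s. (c0 s - w s) * exp (- s)) has_field_derivative 0) (at x)" if "0 < x" for x
        using that by (auto intro!: derivative_eq_intros d0 dw simp: algebra_simps)
    qed (use that \<open>t > 0\<close> in auto)
    have "((\<lambda>s. B * exp (- s)) \<longlongrightarrow> B * 0) at_top"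
      by (intro tendsto_mult tendsto_const filterlim_compose[OF exp_at_bot] filterlim_uminus_at_bot_at_top)
    then have B0: "((\<lambda>s. B * exp (- s)) \<longlongrightarrow> 0) at_top" by simp
    have "\<forall>\<^sub>F s in at_top. norm ((c0 t - w t) * exp (- t)) \<le> B * exp (- s)"
      using eventually_ge_at_top[of 1]
    proof eventually_elim
      case (elim s)
      have "norm ((c0 t - w t) * exp (- t)) = \<bar>c0 s - w s\<bar> * exp (- s)"
        using arg_cong[OF const[of s], of abs] elim by (simp add: abs_mult)
      also have "\<dots> \<le> B * exp (- s)" using bound[OF elim] by (intro mult_right_mono) auto
      finally show ?case .
    qed
    then have "((\<lambda>s. (c0 t - w t) * exp (- t)) \<longlongrightarrow> 0) (at_top :: real filter)"
      by (rule Lim_null_comparison) (rule B0)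
    then have "(c0 t - w t) * exp (- t) = 0"
      by (simp add: tendsto_const_iff)
    then show ?thesis by simp
  qed
  have const: "c0 s * exp s = c0 1 * exp 1" if "s > 0" for s
  proof (rule has_real_derivative_0_eq_on_greaterThan[where c = 0 and f = "\<lambda>s. c0 s * exp s"])
    show "((\<lambda>s. c0 s * exp s) has_field_derivative 0) (at x)" if "0 < x" for x
      using that cw[OF that] by (auto intro!: derivative_eq_intros d0 simp: algebra_simps)
  qed (use that in auto)
  \<comment> \<open>The constant value of \<open>c0 s * exp s\<close> on \<open>s > 0\<close> is its
    right limit at 0, which continuity identifies as \<open>c0 0\<close>.\<close>
  have "isCont c0 0"
    unfolding c0_def One_nat_def by (intro isCont_cos_transform integrable_cauchy_power)
  then have "((\<lambda>s. c0 s * exp s) \<longlongrightarrow> c0 0 * exp 0) (at_right 0)"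
    by (intro tendsto_intros) (auto simp: isCont_def intro: filterlim_mono[OF _ order_refl at_le])
  moreover have "((\<lambda>s. c0 s * exp s) \<longlongrightarrow> c0 1 * exp 1) (at_right 0)"
    by (rule tendsto_eventually) (auto simp: eventually_at_right_less intro!: eventually_mono[OF eventually_at_right_less] const)
  ultimately have 1: "c0 1 * exp 1 = c0 0"
    using tendsto_unique[OF trivial_limit_at_right_real] by fastforce
  moreover have "c0 0 = pi"
    using has_bochner_integral_cauchy by (simp add: c0_def cos_transform_0 has_bochner_integral_iff)
  moreover have "c0 t * exp t = c0 1 * exp 1"
    using const[of t] assms 1 by (cases "t = 0") auto
  ultimately show ?thesis
    unfolding c0_def[symmetric] by (simp add: exp_minus field_simps)
qed

subsection \<open>Characteristic functions of Student densities\<close>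

abbreviation (input) student_half :: "nat \<Rightarrow> real \<Rightarrow> real" where
  "student_half n \<equiv> student_density (real n + 1/2)"

lemma student_density_half_eq:
  "student_half n x = student_const (real n + 1/2) * cauchy_power (Suc n) x"
proof -
  have "(1 + x\<^sup>2) powr (real n + 1/2 + 1/2) = (1 + x\<^sup>2) ^ Suc n"
    using powr_realpow[OF one_plus_square_pos[of x], of "Suc n"] by (simp add: add.commute)
  then show ?thesis by (simp add: student_density_def cauchy_power_def)
qed

lemma student_const_pos: "0 < student_const (real n + 1/2)"
  unfolding student_const_def by (intro divide_pos_pos mult_pos_pos Gamma_real_pos) auto

lemma student_const_half: "student_const (1/2) = 1 / pi"
  by (simp add: student_const_def Gamma_one_half_real)

text \<open>The functional equation of Gamma is applied in numerator and denominator. The ratio is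
  inverse to that in \<open>integral_cauchy_power_Suc\<close>, so the total mass does not depend on
  \<open>n\<close>.\<close>

lemma student_const_Suc:
  "student_const (real (Suc n) + 1/2) * (2 * real n + 1) = student_const (real n + 1/2) * (2 * real n + 2)"
proof -
  define \<nu> where "\<nu> = real n + 1/2"
  have nu: "\<nu> > 0" "real (Suc n) + 1/2 = \<nu> + 1" by (auto simp: \<nu>_def)
  have "\<nu> + 1/2 \<notin> \<int>\<^sub>\<le>\<^sub>0" "\<nu> \<notin> \<int>\<^sub>\<le>\<^sub>0"
    using nu by (auto elim!: nonpos_Ints_cases)
  then have "Gamma (\<nu> + 1 + 1/2) = (\<nu> + 1/2) * Gamma (\<nu> + 1/2)" "Gamma (\<nu> + 1) = \<nu> * Gamma \<nu>"
    using Gamma_plus1[of "\<nu> + 1/2"] Gamma_plus1[of \<nu>] by (simp_all add: algebra_simps)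
  moreover have "Gamma \<nu> > 0" "Gamma (1/2 :: real) > 0" using nu by (auto intro: Gamma_real_pos)
  ultimately have "student_const (\<nu> + 1) * (2 * \<nu>) = student_const \<nu> * (2 * \<nu> + 1)"
    using nu unfolding student_const_def by (simp add: divide_simps)
  then show ?thesis
    unfolding nu(2) by (simp add: \<nu>_def algebra_simps)
qed

lemma cos_transform_cmult: "cos_transform (\<lambda>x. c * g x) t = c * cos_transform g t"
  by (simp add: cos_transform_def mult.left_commute)

text \<open>By the induction hypothesis both sides at \<open>Suc n\<close> have the same derivative
  on \<open>t >= 0\<close>. They agree at 0 because the total mass is preserved and
  \<open>q_(n+1)(0) = 1\<close>.\<close>

lemma cos_transform_student_nonneg:
  assumes "0 \<le> t"
  shows "cos_transform (student_half n) t = exp (- t) * poly (bessel_poly n) t"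
  using assms
proof (induction n arbitrary: t)
  case 0
  have "student_half 0 = (\<lambda>x. 1 / pi * cauchy_power 1 x)"
    using student_density_half_eq[of 0] student_const_half by (intro ext) simp
  then have "cos_transform (student_half 0) t = 1 / pi * cos_transform (cauchy_power 1) t"
    by (simp only: cos_transform_cmult)
  then show ?case
    using cos_transform_cauchy[OF 0] by (simp add: bessel_poly_0)
next
  case (Suc n)
  let ?A = "\<lambda>n. student_const (real n + 1/2)"
  define D where "D t = ?A (Suc n) * cos_transform (cauchy_power (Suc (Suc n))) t
    - exp (- t) * poly (bessel_poly (Suc n)) t" for t
  have A: "?A (Suc n) = ?A n * (2 * real n + 2) / (2 * real n + 1)"
    using student_const_Suc[of n] by (simp add: field_simps add_pos_pos)
  have IH: "?A n * cos_transform (cauchy_power (Suc n)) t = exp (- t) * poly (bessel_poly n) t" if "t \<ge> 0" for t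
    using Suc.IH[OF that] by (simp add: student_density_half_eq[abs_def] cos_transform_cmult)
  have dq: "poly (pderiv (bessel_poly (Suc n))) t = poly (bessel_poly (Suc n)) t - t * poly (bessel_poly n) t / (2 * real n + 1)" for t
    using arg_cong[OF bessel_poly_deriv[of n], of "\<lambda>p. poly p t"] by (simp add: algebra_simps)
  have "(D has_field_derivative 0) (at s)" if "s \<ge> 0" for s
  proof -
    have "(D has_field_derivative ?A (Suc n) * (- s / (2 * real n + 2) * cos_transform (cauchy_power (Suc n)) s)
       - (- exp (- s) * poly (bessel_poly (Suc n)) s + exp (- s) * poly (pderiv (bessel_poly (Suc n))) s)) (at s)"
      unfolding D_def[abs_def]
      by (auto intro!: derivative_eq_intros cos_transform_cauchy_power_deriv poly_DERIV)
    also have "?A (Suc n) * (- s / (2 * real n + 2) * cos_transform (cauchy_power (Suc n)) s)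
      = - s / (2 * real n + 1) * (?A n * cos_transform (cauchy_power (Suc n)) s)"
      unfolding A by (simp add: divide_simps)
    also have "\<dots> - (- exp (- s) * poly (bessel_poly (Suc n)) s + exp (- s) * poly (pderiv (bessel_poly (Suc n))) s) = 0"
      unfolding IH[OF that] dq by (simp add: algebra_simps)
    finally show ?thesis .
  qed
  then have "\<exists>c. \<forall>s\<in>{0..}. D s = c"
    by (intro has_field_derivative_zero_constant) (auto intro: has_field_derivative_at_within)
  then have "D t = D 0" using \<open>0 \<le> t\<close> by fastforce
  also have "D 0 = 0"
  proof -
    have "?A (Suc n) * (2 * real n + 1) * cos_transform (cauchy_power (Suc (Suc n))) 0
      = ?A n * ((2 * real n + 2) * cos_transform (cauchy_power (Suc (Suc n))) 0)"
      unfolding student_const_Suc by simp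
    also have "\<dots> = (2 * real n + 1) * (?A n * cos_transform (cauchy_power (Suc n)) 0)"
      unfolding cos_transform_0 integral_cauchy_power_Suc by simp
    also have "\<dots> = (2 * real n + 1) * 1"
      unfolding IH[OF order_refl] by (simp add: poly_bessel_poly_0)
    finally show ?thesis
      unfolding D_def poly_bessel_poly_0 by (simp add: mult_ac)
  qed
  finally have "D t = 0" .
  moreover have "cos_transform (student_half (Suc n)) t = ?A (Suc n) * cos_transform (cauchy_power (Suc (Suc n))) t"
    by (simp only: student_density_half_eq[abs_def] cos_transform_cmult)
  ultimately show ?case by (simp add: D_def)
qed

lemma cos_transform_student:
  "cos_transform (student_half n) t = exp (- \<bar>t\<bar>) * poly (bessel_poly n) \<bar>t\<bar>"
  using cos_transform_student_nonneg[of "\<bar>t\<bar>" n] cos_transform_minus[of "student_half n" t]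
  by (auto simp: abs_if)

subsection \<open>Convolutions via Levy's uniqueness theorem\<close>

lemma sin_transform_even:
  assumes "\<And>x. g (- x) = g x"
  shows "sin_transform g t = 0"
proof -
  have "sin_transform g t = (\<integral>x. sin (t * (0 + (- 1) * x)) * g (0 + (- 1) * x) \<partial>lborel)"
    unfolding sin_transform_def by (subst lborel_integral_real_affine[of "- 1" _ 0]) auto
  also have "\<dots> = - sin_transform g t"
    by (simp add: sin_transform_def assms)
  finally show ?thesis by simp
qed

text \<open>The imaginary part is the sine transform, which evenness annihilates.\<close>

lemma char_density_even:
  assumes g: "integrable lborel g" "\<And>x. 0 \<le> g x" "\<And>x. g (- x) = g x"
  shows "char (density lborel (\<lambda>x. ennreal (g x))) t = of_real (cos_transform g t)"
proof -
  have [measurable]: "g \<in> borel_measurable borel" using g(1) by auto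
  have int: "integrable lborel (\<lambda>x. g x *\<^sub>R iexp (t * x))"
    using g(1) by (rule Bochner_Integration.integrable_bound) (auto simp: g(2))
  have "char (density lborel (\<lambda>x. ennreal (g x))) t = (\<integral>x. g x *\<^sub>R iexp (t * x) \<partial>lborel)"
    unfolding char_def using g(2) by (subst integral_density) auto
  also have "\<dots> = of_real (cos_transform g t)"
  proof (rule complex_eqI)
    show "Re (\<integral>x. g x *\<^sub>R iexp (t * x) \<partial>lborel) = Re (of_real (cos_transform g t))"
      using int by (simp add: cos_transform_def Re_exp mult.commute flip: integral_Re)
    have "Im (\<integral>x. g x *\<^sub>R iexp (t * x) \<partial>lborel) = sin_transform g t"
      using int by (simp add: sin_transform_def Im_exp mult.commute flip: integral_Im)
    then show "Im (\<integral>x. g x *\<^sub>R iexp (t * x) \<partial>lborel) = Im (of_real (cos_transform g t))"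
      using sin_transform_even[of g, OF g(3)] by simp
  qed
  finally show ?thesis .
qed

lemma convolution_real_distribution:
  assumes "real_distribution M" "real_distribution N"
  shows "real_distribution (M \<star> N)"
    and "char (M \<star> N) t = char M t * char N t"
proof -
  interpret M: real_distribution M by fact
  interpret N: real_distribution N by fact
  interpret P: pair_prob_space M N ..
  have meas [measurable]: "(\<lambda>(x, y). x + y) \<in> borel_measurable (M \<Otimes>\<^sub>M N)" by measurable
  show "real_distribution (M \<star> N)"
    unfolding convolution_def by (rule P.real_distribution_distr) (rule meas)
  have "integrable (M \<Otimes>\<^sub>M N) (\<lambda>(x, y). iexp (t * x) * iexp (t * y))"
    by (rule P.integrable_const_bound[of _ 1]) (auto simp: norm_mult)
  then have "(CLINT z|M \<Otimes>\<^sub>M N. (case z of (x, y) \<Rightarrow> iexp (t * x) * iexp (t * y)))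
    = (CLINT x|M. CLINT y|N. iexp (t * x) * iexp (t * y))"
    by (subst P.integral_fst'[symmetric]) auto
  then show "char (M \<star> N) t = char M t * char N t"
    unfolding char_def convolution_def
    by (simp add: integral_distr split_beta' distrib_left exp_add)
qed

lemma real_distribution_density:
  assumes "integrable lborel g" "\<And>x. 0 \<le> g x" "(\<integral>x. g x \<partial>lborel) = 1"
  shows "real_distribution (density lborel (\<lambda>x. ennreal (g x)))"
proof -
  have "(\<integral>\<^sup>+x. ennreal (g x) \<partial>lborel) = 1"
    using assms by (subst nn_integral_eq_integral) auto
  moreover have "g \<in> borel_measurable borel" using assms(1) by auto
  ultimately have "prob_space (density lborel (\<lambda>x. ennreal (g x)))"
    by (intro prob_spaceI) (simp add: emeasure_density)
  then show ?thesis
    by (simp add: real_distribution_def real_distribution_axioms_def)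
qed

text \<open>By continuity the set of disagreement is open; it is also null, hence empty.\<close>

lemma AE_lborel_eq_imp_eq:
  fixes f g :: "real \<Rightarrow> real"
  assumes "\<And>x. isCont f x" "\<And>x. isCont g x" "AE x in lborel. f x = g x"
  shows "f x = g x"
proof -
  have open_ne: "open {x. f x \<noteq> g x}"
    using assms(1,2) by (intro open_Collect_neq continuous_at_imp_continuous_on) auto
  then have "{x. f x \<noteq> g x} \<in> null_sets lborel"
    using assms(3) by (subst AE_iff_null_sets) auto
  then have "negligible {x. f x \<noteq> g x}"
    by (simp add: negligible_iff_null_sets null_sets_completionI)
  then show ?thesis
    using open_not_negligible[OF open_ne] by auto
qed

lemma nn_integral_convolution_eq_fun_convolution:
  assumes "\<And>x. 0 \<le> f x" "\<And>x. 0 \<le> g x" "integrable lborel (\<lambda>y. f (x - y) * g y)"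
  shows "(\<integral>\<^sup>+y. ennreal (f (x - y)) * ennreal (g y) \<partial>lborel) = ennreal (fun_convolution f g x)"
proof -
  have "(\<integral>\<^sup>+y. ennreal (f (x - y)) * ennreal (g y) \<partial>lborel) = (\<integral>\<^sup>+y. ennreal (f (x - y) * g y) \<partial>lborel)"
    using assms by (simp add: ennreal_mult)
  also have "\<dots> = ennreal (fun_convolution f g x)"
    unfolding fun_convolution_def using assms by (intro nn_integral_eq_integral) auto
  finally show ?thesis .
qed

text \<open>Equal characteristic functions give equal laws, hence densities equal almost everywhere.
  The function \<open>B * g\<close> dominates the convolution integrand, which yields both
  integrability and continuity of the convolution, and continuity removes the exceptional
  set.\<close>

lemma fun_convolution_eq_by_cos_transform:
  fixes f g h :: "real \<Rightarrow> real"
  assumes cont: "\<And>x. isCont f x" "\<And>x. isCont h x"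
    and int: "integrable lborel f" "integrable lborel g" "integrable lborel h"
    and nonneg: "\<And>x. 0 \<le> f x" "\<And>x. 0 \<le> g x" "\<And>x. 0 \<le> h x"
    and even: "\<And>x. f (- x) = f x" "\<And>x. g (- x) = g x" "\<And>x. h (- x) = h x"
    and total: "(\<integral>x. f x \<partial>lborel) = 1" "(\<integral>x. g x \<partial>lborel) = 1" "(\<integral>x. h x \<partial>lborel) = 1"
    and bound: "\<And>x. f x \<le> B"
    and eq: "\<And>t. cos_transform f t * cos_transform g t = cos_transform h t"
  shows "integrable lborel (\<lambda>y. f (x - y) * g y) \<and> fun_convolution f g x = h x"
proof -
  have [measurable]: "f \<in> borel_measurable borel" "g \<in> borel_measurable borel" "h \<in> borel_measurable borel"
    using int by auto
  have intB: "integrable lborel (\<lambda>y. B * g y)" using int by simp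
  have le: "\<bar>f (x - y) * g y\<bar> \<le> B * g y" for x y
    using nonneg bound by (simp add: abs_mult mult_right_mono)
  have int_conv: "integrable lborel (\<lambda>y. f (x - y) * g y)" for x
    using intB by (rule Bochner_Integration.integrable_bound) (use le in \<open>auto intro: order_trans[OF _ abs_ge_self]\<close>)
  have cont_conv: "isCont (fun_convolution f g) x" for x
    unfolding fun_convolution_def[abs_def]
  proof (rule isCont_lebesgue_integral[where w = "\<lambda>y. B * g y"])
    show "isCont (\<lambda>s. f (s - y) * g y) x" for y
      by (intro continuous_intros isCont_o2[OF _ cont(1)])
  qed (use intB le in auto)
  have nonneg_conv: "0 \<le> fun_convolution f g x" for x
    unfolding fun_convolution_def using nonneg by (intro integral_nonneg_AE) auto
  let ?D = "\<lambda>f. density lborel (\<lambda>x. ennreal (f x))"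
  interpret F: real_distribution "?D f" using int nonneg total by (intro real_distribution_density)
  interpret G: real_distribution "?D g" using int nonneg total by (intro real_distribution_density)
  have "?D f \<star> ?D g = density lborel (\<lambda>x. \<integral>\<^sup>+y. ennreal (f (x - y)) * ennreal (g y) \<partial>lborel)"
    by (rule convolution_density) (auto intro: F.finite_measure_axioms G.finite_measure_axioms)
  also have "(\<lambda>x. \<integral>\<^sup>+y. ennreal (f (x - y)) * ennreal (g y) \<partial>lborel) = (\<lambda>x. ennreal (fun_convolution f g x))"
    using nonneg int_conv by (intro ext nn_integral_convolution_eq_fun_convolution)
  also have "?D f \<star> ?D g = ?D h"
  proof (rule Levy_uniqueness)
    show "real_distribution (?D f \<star> ?D g)"
      by (intro convolution_real_distribution F.real_distribution_axioms G.real_distribution_axioms)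
    show "real_distribution (?D h)" using int nonneg total by (intro real_distribution_density)
    show "char (?D f \<star> ?D g) = char (?D h)"
      unfolding fun_eq_iff
      using int nonneg even
      by (simp add: convolution_real_distribution(2)[OF F.real_distribution_axioms G.real_distribution_axioms]
          char_density_even eq flip: of_real_mult)
  qed
  finally have "?D h = ?D (fun_convolution f g)" .
  moreover have [measurable]: "fun_convolution f g \<in> borel_measurable borel"
    using cont_conv by (intro borel_measurable_continuous_onI continuous_at_imp_continuous_on) auto
  ultimately have "AE x in lborel. ennreal (h x) = ennreal (fun_convolution f g x)"
    by (intro sigma_finite_measure.density_unique[OF lborel.sigma_finite_measure_axioms]) auto
  then have "AE x in lborel. h x = fun_convolution f g x"
    using nonneg nonneg_conv by simp
  then have "h x = fun_convolution f g x"
    using cont_conv cont(2) by (intro AE_lborel_eq_imp_eq)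
  with int_conv show ?thesis by simp
qed

subsection \<open>Convex combinations of Student densities\<close>

lemma student_half_nonneg: "0 \<le> student_half n x"
  unfolding student_density_half_eq
  by (intro mult_nonneg_nonneg less_imp_le student_const_pos cauchy_power_pos)

lemma student_half_le: "student_half n x \<le> student_const (real n + 1/2)"
proof -
  have "cauchy_power (Suc n) x \<le> 1"
    using cauchy_power_antimono[of 0 "Suc n" x] by (simp add: cauchy_power_def)
  then show ?thesis
    unfolding student_density_half_eq
    using mult_left_le[of "cauchy_power (Suc n) x"] student_const_pos[of n] by simp
qed

lemma student_half_even: "student_half n (- x) = student_half n x"
  by (simp add: student_density_def)

lemma isCont_student_half: "isCont (student_half n) x"
  unfolding student_density_half_eq[abs_def] by (intro continuous_intros isCont_cauchy_power)

lemma integrable_student_half: "integrable lborel (student_half n)"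
  unfolding student_density_half_eq[abs_def] by (intro integrable_mult_right integrable_cauchy_power)

lemma integral_student_half: "(\<integral>x. student_half n x \<partial>lborel) = 1"
  using cos_transform_student[of n 0] by (simp add: cos_transform_0 poly_bessel_poly_0)

section \<open>Scaling, finite combinations and the convolution identity\<close>

lemma cos_transform_scaled:
  assumes "0 < a"
  shows "cos_transform (scaled_density a f) t = cos_transform f (a * t)"
proof -
  have "cos_transform (scaled_density a f) t
    = \<bar>a\<bar> *\<^sub>R (\<integral>x. cos (t * (0 + a * x)) * scaled_density a f (0 + a * x) \<partial>lborel)"
    unfolding cos_transform_def using assms by (intro lborel_integral_real_affine) auto
  also have "\<dots> = cos_transform f (a * t)"
    using assms by (simp add: cos_transform_def scaled_density_def mult_ac)
  finally show ?thesis .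
qed

lemma integrable_scaled:
  assumes "0 < a" "integrable lborel f"
  shows "integrable lborel (scaled_density a f)"
proof -
  have "integrable lborel (\<lambda>x. f (0 + inverse a * x))"
    using assms by (intro lborel_integrable_real_affine) auto
  then show ?thesis
    unfolding scaled_density_def[abs_def] using assms(1)
    by (intro integrable_mult_right) (simp add: divide_inverse mult.commute)
qed

lemma isCont_scaled:
  assumes "0 < a" "\<And>x. isCont f x"
  shows "isCont (scaled_density a f) x"
  unfolding scaled_density_def[abs_def] using assms
  by (intro continuous_intros isCont_o2[OF _ assms(2)]) auto

lemma integral_scaled:
  assumes "0 < a"
  shows "(\<integral>x. scaled_density a f x \<partial>lborel) = (\<integral>x. f x \<partial>lborel)"
  using cos_transform_scaled[OF assms, of f 0] by (simp add: cos_transform_0)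

lemma cos_transform_sum:
  assumes "\<And>k. k \<in> A \<Longrightarrow> integrable lborel (f k)"
  shows "cos_transform (\<lambda>x. \<Sum>k\<in>A. c k * f k x) t = (\<Sum>k\<in>A. c k * cos_transform (f k) t)"
proof -
  have "(\<integral>x. (\<Sum>k\<in>A. c k * (cos (t * x) * f k x)) \<partial>lborel) = (\<Sum>k\<in>A. c k * cos_transform (f k) t)"
    using assms by (subst Bochner_Integration.integral_sum) (auto intro!: integrable_cos_mult simp: cos_transform_def)
  then show ?thesis
    by (simp add: cos_transform_def sum_distrib_left mult_ac)
qed

text \<open>The exponents \<open>a |t|\<close> and \<open>(1 - a) |t|\<close> add up to
  \<open>|t|\<close>, so the transforms match by the polynomial identity at \<open>u = |t|\<close>.
  Nonnegativity of the coefficients makes the right side a probability density.\<close>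

lemma student_convolution:
  assumes a: "0 < a" "a < 1" and \<beta>: "bessel_product_expansion n m a \<beta>"
  shows "integrable lborel (\<lambda>y. scaled_density a (student_half n) (x - y) * scaled_density (1 - a) (student_half m) y)"
    and "fun_convolution (scaled_density a (student_half n)) (scaled_density (1 - a) (student_half m)) x
      = (\<Sum>k=min n m..n + m. \<beta> k * student_half k x)"
proof -
  have scaled_nonneg: "0 \<le> scaled_density c (student_half k) x" if "0 < c" for c k x
    using that student_half_nonneg by (simp add: scaled_density_def)
  have scaled_even: "scaled_density c (student_half k) (- x) = scaled_density c (student_half k) x" for c k x
    using student_half_even[of k "x / c"] by (simp add: scaled_density_def)
  have \<beta>_nonneg: "0 \<le> \<beta> k" if "k \<in> {min n m..n + m}" for k
    using bessel_product_expansion_nonneg[OF _ _ \<beta> that] a by simp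
  have transform: "cos_transform (\<lambda>x. \<Sum>k=min n m..n + m. \<beta> k * student_half k x) t
    = (\<Sum>k=min n m..n + m. \<beta> k * (exp (- \<bar>t\<bar>) * poly (bessel_poly k) \<bar>t\<bar>))" for t
    by (subst cos_transform_sum) (auto simp: integrable_student_half cos_transform_student)
  have "integrable lborel (\<lambda>y. scaled_density a (student_half n) (x - y) * scaled_density (1 - a) (student_half m) y)
    \<and> fun_convolution (scaled_density a (student_half n)) (scaled_density (1 - a) (student_half m)) x
      = (\<Sum>k=min n m..n + m. \<beta> k * student_half k x)"
  proof (rule fun_convolution_eq_by_cos_transform[where f = "scaled_density a (student_half n)"
        and g = "scaled_density (1 - a) (student_half m)" and h = "\<lambda>x. \<Sum>k=min n m..n + m. \<beta> k * student_half k x"])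
    show "isCont (scaled_density a (student_half n)) x" for x
      using a by (intro isCont_scaled isCont_student_half)
    show "isCont (\<lambda>x. \<Sum>k=min n m..n + m. \<beta> k * student_half k x) x" for x
      by (intro continuous_intros isCont_student_half)
    show "integrable lborel (scaled_density a (student_half n))" "integrable lborel (scaled_density (1 - a) (student_half m))"
      using a by (auto intro!: integrable_scaled integrable_student_half)
    show "integrable lborel (\<lambda>x. \<Sum>k=min n m..n + m. \<beta> k * student_half k x)"
      by (intro Bochner_Integration.integrable_sum integrable_mult_right integrable_student_half)
    show "0 \<le> scaled_density a (student_half n) x" "0 \<le> scaled_density (1 - a) (student_half m) x" for x
      using a by (auto intro!: scaled_nonneg)
    show "0 \<le> (\<Sum>k=min n m..n + m. \<beta> k * student_half k x)" for x
      by (intro sum_nonneg mult_nonneg_nonneg \<beta>_nonneg student_half_nonneg)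
    show "scaled_density a (student_half n) (- x) = scaled_density a (student_half n) x"
      "scaled_density (1 - a) (student_half m) (- x) = scaled_density (1 - a) (student_half m) x" for x
      by (rule scaled_even)+
    show "(\<Sum>k=min n m..n + m. \<beta> k * student_half k (- x)) = (\<Sum>k=min n m..n + m. \<beta> k * student_half k x)" for x
      by (simp only: student_half_even)
    show "(\<integral>x. scaled_density a (student_half n) x \<partial>lborel) = 1" "(\<integral>x. scaled_density (1 - a) (student_half m) x \<partial>lborel) = 1"
      using a by (simp_all add: integral_scaled integral_student_half)
    show "(\<integral>x. (\<Sum>k=min n m..n + m. \<beta> k * student_half k x) \<partial>lborel) = 1"
      using transform[of 0] bessel_product_expansion_sum[OF \<beta>] by (simp add: cos_transform_0 poly_bessel_poly_0)
    show "scaled_density a (student_half n) x \<le> 1 / a * student_const (real n + 1/2)" for x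
      unfolding scaled_density_def using a student_half_le by (intro mult_left_mono) auto
    show "cos_transform (scaled_density a (student_half n)) t * cos_transform (scaled_density (1 - a) (student_half m)) t
      = cos_transform (\<lambda>x. \<Sum>k=min n m..n + m. \<beta> k * student_half k x) t" for t
    proof -
      have "exp (- (a * \<bar>t\<bar>)) * exp (- ((1 - a) * \<bar>t\<bar>)) = exp (- \<bar>t\<bar>)"
        by (simp add: algebra_simps flip: exp_add)
      then have "exp (- (a * \<bar>t\<bar>)) * P * (exp (- ((1 - a) * \<bar>t\<bar>)) * Q) = exp (- \<bar>t\<bar>) * (P * Q)" for P Q
        by (metis mult.assoc mult.left_commute)
      then have "cos_transform (scaled_density a (student_half n)) t * cos_transform (scaled_density (1 - a) (student_half m)) t
        = exp (- \<bar>t\<bar>) * (poly (bessel_poly n) (a * \<bar>t\<bar>) * poly (bessel_poly m) ((1 - a) * \<bar>t\<bar>))"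
        using a by (simp add: cos_transform_scaled cos_transform_student abs_mult)
      then show ?thesis
        unfolding transform bessel_product_expansion_poly[OF \<beta>]
        by (simp add: sum_distrib_left mult.left_commute)
    qed
  qed
  then show "integrable lborel (\<lambda>y. scaled_density a (student_half n) (x - y) * scaled_density (1 - a) (student_half m) y)"
    and "fun_convolution (scaled_density a (student_half n)) (scaled_density (1 - a) (student_half m)) x
      = (\<Sum>k=min n m..n + m. \<beta> k * student_half k x)"
    by auto
qed

section \<open>Independent random variables\<close>

lemma (in prob_space) distributed_scaled:
  assumes "distributed M lborel X (\<lambda>x. ennreal (f x))" "0 < a" "\<And>x. 0 \<le> f x"
  shows "distributed M lborel (\<lambda>\<omega>. a * X \<omega>) (\<lambda>x. ennreal (scaled_density a f x))"
  using distributed_affine[OF assms(1), of a 0] assms(2,3)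
  by (simp add: divide_ennreal scaled_density_def)

lemma (in prob_space) distributed_student_combination:
  assumes a: "0 < a" "a < 1" and \<beta>: "bessel_product_expansion n m a \<beta>"
    and X: "distributed M lborel X (\<lambda>x. ennreal (student_half n x))"
    and Y: "distributed M lborel Y (\<lambda>x. ennreal (student_half m x))"
    and indep: "indep_var borel X borel Y"
  shows "distributed M lborel (\<lambda>\<omega>. a * X \<omega> + (1 - a) * Y \<omega>)
    (\<lambda>x. ennreal (\<Sum>k=min n m..n + m. \<beta> k * student_half k x))"
proof -
  have "indep_var borel (\<lambda>\<omega>. a * X \<omega>) borel (\<lambda>\<omega>. (1 - a) * Y \<omega>)"
    using indep_var_compose[OF indep, of "\<lambda>x. a * x" borel "\<lambda>x. (1 - a) * x" borel] by (simp add: o_def)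
  moreover have "distributed M lborel (\<lambda>\<omega>. a * X \<omega>) (\<lambda>x. ennreal (scaled_density a (student_half n) x))"
    "distributed M lborel (\<lambda>\<omega>. (1 - a) * Y \<omega>) (\<lambda>x. ennreal (scaled_density (1 - a) (student_half m) x))"
    using a by (auto intro!: distributed_scaled X Y student_half_nonneg)
  ultimately have "distributed M lborel (\<lambda>\<omega>. a * X \<omega> + (1 - a) * Y \<omega>)
    (\<lambda>x. \<integral>\<^sup>+y. ennreal (scaled_density a (student_half n) (x - y)) * ennreal (scaled_density (1 - a) (student_half m) y) \<partial>lborel)"
    by (rule distributed_convolution)
  moreover have "(\<integral>\<^sup>+y. ennreal (scaled_density a (student_half n) (x - y)) * ennreal (scaled_density (1 - a) (student_half m) y) \<partial>lborel)
    = ennreal (\<Sum>k=min n m..n + m. \<beta> k * student_half k x)" for x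
    unfolding student_convolution(2)[OF a \<beta>, symmetric]
    using a student_convolution(1)[OF a \<beta>] student_half_nonneg
    by (intro nn_integral_convolution_eq_fun_convolution) (auto simp: scaled_density_def)
  ultimately show ?thesis by simp
qed

theorem mainTheorem4:
  fixes n m :: nat and a :: real
  assumes "0 < a" and "a < 1"
  shows "(\<exists>!\<beta>. bessel_product_expansion n m a \<beta> \<and> (\<forall>k. k \<notin> {min n m..n + m} \<longrightarrow> \<beta> k = 0)) \<and>
    (\<forall>\<beta>. bessel_product_expansion n m a \<beta> \<longrightarrow>
      (\<forall>k\<in>{min n m..n + m}. \<beta> k \<ge> 0) \<and>
      (\<Sum>k=min n m..n + m. \<beta> k) = 1 \<and>
      (\<forall>x.
        integrable lborel (\<lambda>y. scaled_density a (student_density (real n + 1/2)) (x - y)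
                             * scaled_density (1 - a) (student_density (real m + 1/2)) y) \<and>
        fun_convolution (scaled_density a (student_density (real n + 1/2)))
                        (scaled_density (1 - a) (student_density (real m + 1/2))) x
          = (\<Sum>k=min n m..n + m. \<beta> k * student_density (real k + 1/2) x)) \<and>
      (\<forall>(M :: 'w measure) X Y.
        prob_space M \<and>
        distributed M lborel X (\<lambda>x. ennreal (student_density (real n + 1/2) x)) \<and>
        distributed M lborel Y (\<lambda>x. ennreal (student_density (real m + 1/2) x)) \<and>
        prob_space.indep_var M borel X borel Y \<longrightarrow>
        distributed M lborel (\<lambda>\<omega>. a * X \<omega> + (1 - a) * Y \<omega>)
          (\<lambda>x. ennreal (\<Sum>k=min n m..n + m. \<beta> k * student_density (real k + 1/2) x))))"
proof (intro conjI allI impI ballI)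
  \<comment> \<open>The expansion constrains coefficients only on its index range; the value 0
    elsewhere makes the coefficient function unique.\<close>
  obtain \<gamma> where \<gamma>: "bessel_product_expansion n m a \<gamma>" "\<And>k. k \<notin> {min n m..n + m} \<Longrightarrow> \<gamma> k = 0"
    using bessel_product_expansion_exists[of a n m] assms by (metis less_imp_le)
  then show "\<exists>!\<beta>. bessel_product_expansion n m a \<beta> \<and> (\<forall>k. k \<notin> {min n m..n + m} \<longrightarrow> \<beta> k = 0)"
  proof (intro ex1I[of _ \<gamma>] conjI allI impI ext)
    fix \<beta> k assume "bessel_product_expansion n m a \<beta> \<and> (\<forall>k. k \<notin> {min n m..n + m} \<longrightarrow> \<beta> k = 0)"
    then show "\<beta> k = \<gamma> k"
      using \<gamma> bessel_product_expansion_unique[of n m a \<beta> \<gamma> k] by (cases "k \<in> {min n m..n + m}") auto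
  qed
next
  fix \<beta> assume \<beta>: "bessel_product_expansion n m a \<beta>"
  show "0 \<le> \<beta> k" if "k \<in> {min n m..n + m}" for k
    using bessel_product_expansion_nonneg[OF _ _ \<beta> that] assms by simp
  show "(\<Sum>k=min n m..n + m. \<beta> k) = 1"
    by (rule bessel_product_expansion_sum[OF \<beta>])
  show "integrable lborel (\<lambda>y. scaled_density a (student_half n) (x - y) * scaled_density (1 - a) (student_half m) y)"
    and "fun_convolution (scaled_density a (student_half n)) (scaled_density (1 - a) (student_half m)) x
      = (\<Sum>k=min n m..n + m. \<beta> k * student_half k x)" for x
    by (rule student_convolution[OF assms \<beta>])+
  show "distributed M lborel (\<lambda>\<omega>. a * X \<omega> + (1 - a) * Y \<omega>)
    (\<lambda>x. ennreal (\<Sum>k=min n m..n + m. \<beta> k * student_half k x))"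
    if "prob_space M \<and>
        distributed M lborel X (\<lambda>x. ennreal (student_half n x)) \<and>
        distributed M lborel Y (\<lambda>x. ennreal (student_half m x)) \<and>
        prob_space.indep_var M borel X borel Y" for M :: "'w measure" and X Y
    using that prob_space.distributed_student_combination[OF _ assms \<beta>] by blast
qed

end
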